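(* Let $b$ be a graph over an at most countable set $X$, let $\emptyset\neq A\subsetneq X$, and let $\partial_v A$, $\bar A=A\cup\partial_v A$, $b_{\bar A}$ be the associated vertex boundary, closure and induced graph. Assume that the graph $b_{\bar A}$ on $\bar A$ is connected, that $(\bar A,m)$ is a finite discrete measure space, and that the semigroup $(e^{-tL_{\bar A}})_{t>0}$ of the Neumann Laplacian $L_{\bar A}$ for $b_{\bar A}$ is ultracontractive. Let $\varphi\in\ell^\infty(\partial_v A)$ be such that $\sum_{x\in\partial_v A}\varphi(x)m(x)=0$. (i) There is a unique function $u:\bar A\to\mathbb{R}$ that solves the Neumann problem for $\varphi$ and satisfies $\sum_{x\in\bar A}u(x)m(x)=0$. (ii) For this function $u$ and for every $x\in\bar A$ we have $$u(x)=\lim_{t\to\infty}\mathbb{E}_x\int_0^t\varphi(Y_s)\,dL_s=\int_0^\infty\sum_{y\in\partial_v A}\varphi(y)p_s(x,y)m(y)\,ds=\sum_{y\in\partial_v A}\varphi(y)g(x,y)m(y),$$ where $Y$ is the Markov process associated with the Neumann form $Q_{\bar A}$, $(L_t)_{t\ge0}$ is its local time on $\partial_v A$, $p_t(\cdot,\cdot)$ is the heat kernel of $(e^{-tL_{\bar A}})_{t>0}$ and $g$ is the Green kernel.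
   Context: A graph on an at most countable set $X$ is a symmetric function $b:X\times X\to[0,\infty)$ vanishing on the diagonal with $\sum_{y\in X}b(x,y)<\infty$ for every $x\in X$. It is connected if for all $x,y\in X$ there are $x_1,\dots,x_n\in X$ with $b(x,x_1)>0,\ b(x_1,x_2)>0,\dots,b(x_n,y)>0$. The vertex boundary of $A$ is $\partial_v A=\{y\in X\setminus A:\text{ there is }x\in A\text{ with }b(x,y)>0\}$, and $\bar A=A\cup\partial_v A$. The induced graph $b_{\bar A}$ on $\bar A$ is $b_{\bar A}(x,y)=b(x,y)$ if $x,y\in A$, or $x\in A,y\in\partial_v A$, or $x\in\partial_v A,y\in A$, and $b_{\bar A}(x,y)=0$ otherwise. $(\bar A,m)$ is a finite discrete measure space: $m:\bar A\to(0,\infty)$ with $m(\bar A)=\sum_{x\in\bar A}m(x)<\infty$; $m(B)=\sum_{x\in B}m(x)$. For $B\subseteq\bar A$, $\ell^2(B,m)$ is the space of real functions on $B$ square-summable with respect to $m$, with $\langle f,g\rangle_{\ell^2(B,m)}=\sum_{x\in B}f(x)g(x)m(x)$. Neumann form: $Q_{\bar A}(u,v)=\frac12\sum_{x,y\in\bar A}b_{\bar A}(x,y)(u(x)-u(y))(v(x)-v(y))$ for $u,v\in D(Q_{\bar A})=\{u\in\ell^2(\bar A,m): Q_{\bar A}(u,u)<\infty\}$. The Neumann Laplacian $L_{\bar A}$ is the nonnegative self-adjoint generator of $Q_{\bar A}$ on $\ell^2(\bar A,m)$: $D(L_{\bar A})$ is the set of $u\in D(Q_{\bar A})$ for which there is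 $f\in\ell^2(\bar A,m)$ with $Q_{\bar A}(u,v)=\langle f,v\rangle_{\ell^2(\bar A,m)}$ for all $v\in D(Q_{\bar A})$, and then $L_{\bar A}u=f$. For $f:\bar A\to\mathbb{R}$ with $\sum_{y\in\bar A}b_{\bar A}(x,y)|f(y)|<\infty$ for all $x\in\bar A$ (in particular for $f\in D(Q_{\bar A})$) let $\widetilde L_{\bar A}f(x)=\frac1{m(x)}\sum_{y\in\bar A}b_{\bar A}(x,y)(f(x)-f(y))$, and let $\Delta_A f(x)=\widetilde L_{\bar A}f(x)$ for $x\in A$, $\Delta_A f(x)=0$ for $x\in\partial_v A$. A function $\psi\in\ell^2(\partial_v A,m)$ is a normal derivative of $u\in D(Q_{\bar A})$ if $Q_{\bar A}(u,v)-\langle\Delta_A u,v\rangle_{\ell^2(A,m)}=\langle\psi,v\rangle_{\ell^2(\partial_v A,m)}$ for every $v\in D(Q_{\bar A})$; it is then unique and denoted $\frac{\partial}{\partial n}u$. A function $u\in D(Q_{\bar A})$ solves the Neumann problem for $\varphi\in\ell^2(\partial_v A,m)$ if $\Delta_A u(x)=0$ for every $x\in A$ and $u$ has normal derivative $\frac{\partial}{\partial n}u(y)=\varphi(y)$ for every $y\in\partial_v A$. The semigroup $(e^{-tL_{\bar A}})_{t>0}$ is ultracontractive if there is a decreasing function $\gamma:(0,\infty)\to(0,\infty)$ with $\|e^{-tL_{\bar A}}u\|_\infty\le\gamma(t)\|u\|_{\ell^2(\bar A,m)}$ for all $t>0$, $u\in\ell^2(\bar A,m)$. $Y=(Y_t)_{t\ge0}$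 is the (jointly measurable) continuous-time Markov process with state space $\bar A$ associated with $Q_{\bar A}$, i.e. $e^{-tL_{\bar A}}f(x)=\mathbb{E}_x f(Y_t)$ for all $f\in\ell^2(\bar A,m)$, $t\geq 0$, $x\in\bar A$. Its local time on $\partial_v A$ is $L_t=\int_0^t\mathbf 1_{\{Y_s\in\partial_v A\}}\,ds$, $t\ge0$; in $\int_0^t\varphi(Y_s)\,dL_s$ the function $\varphi$ is understood to be extended by $0$ to $\bar A$. The heat kernel is $p_t(x,y)=\frac1{m(y)}e^{-tL_{\bar A}}1_y(x)$, $x,y\in\bar A$, where $1_y$ is the indicator function of $\{y\}$. The Green kernel is $g(x,y)=\int_0^\infty\left(p_t(x,y)-\frac1{m(\bar A)}\right)dt$, $x,y\in\bar A$ (the integral exists under the stated assumptions). *)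

theory Defs
  imports "HOL-Probability.Probability"
begin

section \<open>Graphs, boundary and induced graph\<close>

definition graph_on :: "'a set \<Rightarrow> ('a \<Rightarrow> 'a \<Rightarrow> real) \<Rightarrow> bool" where
  "graph_on X b \<longleftrightarrow> countable X
     \<and> (\<forall>x\<in>X. \<forall>y\<in>X. 0 \<le> b x y \<and> b x y = b y x)
     \<and> (\<forall>x\<in>X. b x x = 0)
     \<and> (\<forall>x\<in>X. (\<lambda>y. b x y) summable_on X)"

definition connected_graph :: "'a set \<Rightarrow> ('a \<Rightarrow> 'a \<Rightarrow> real) \<Rightarrow> bool" where
  "connected_graph V b \<longleftrightarrow>
     (\<forall>x\<in>V. \<forall>y\<in>V. (x, y) \<in> {(z, w). z \<in> V \<and> w \<in> V \<and> 0 < b z w}\<^sup>+)"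

definition vertex_boundary :: "'a set \<Rightarrow> ('a \<Rightarrow> 'a \<Rightarrow> real) \<Rightarrow> 'a set \<Rightarrow> 'a set" where
  "vertex_boundary X b A = {y \<in> X - A. \<exists>x\<in>A. 0 < b x y}"

definition vertex_closure :: "'a set \<Rightarrow> ('a \<Rightarrow> 'a \<Rightarrow> real) \<Rightarrow> 'a set \<Rightarrow> 'a set" where
  "vertex_closure X b A = A \<union> vertex_boundary X b A"

definition induced_graph :: "'a set \<Rightarrow> ('a \<Rightarrow> 'a \<Rightarrow> real) \<Rightarrow> 'a set \<Rightarrow> 'a \<Rightarrow> 'a \<Rightarrow> real" where
  "induced_graph X b A x y =
     (if (x \<in> A \<and> y \<in> A) \<or> (x \<in> A \<and> y \<in> vertex_boundary X b A)
         \<or> (x \<in> vertex_boundary X b A \<and> y \<in> A)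
      then b x y else 0)"


section \<open>Function spaces\<close>

text \<open>
  A real function on a set \<open>B\<close> is encoded as a total function that vanishes outside \<open>B\<close>.
  So equality of functions on \<open>B\<close> is equality in HOL, and for \<open>B \<subseteq> V\<close> a function on \<open>B\<close>
  is at the same time its extension by \<open>0\<close> to \<open>V\<close>.
\<close>

definition functions_on :: "'a set \<Rightarrow> ('a \<Rightarrow> real) set" where
  "functions_on B = {f. \<forall>x. x \<notin> B \<longrightarrow> f x = 0}"

definition finite_discrete_measure :: "'a set \<Rightarrow> ('a \<Rightarrow> real) \<Rightarrow> bool" where
  "finite_discrete_measure V m \<longleftrightarrow> (\<forall>x\<in>V. 0 < m x) \<and> m summable_on V"

definition ell2 :: "'a set \<Rightarrow> ('a \<Rightarrow> real) \<Rightarrow> ('a \<Rightarrow> real) set" where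
  "ell2 B m = {f \<in> functions_on B. (\<lambda>x. (f x)\<^sup>2 * m x) summable_on B}"

definition ell2_inner :: "'a set \<Rightarrow> ('a \<Rightarrow> real) \<Rightarrow> ('a \<Rightarrow> real) \<Rightarrow> ('a \<Rightarrow> real) \<Rightarrow> real" where
  "ell2_inner B m f g = (\<Sum>\<^sub>\<infinity>x\<in>B. f x * g x * m x)"

definition ell2_norm :: "'a set \<Rightarrow> ('a \<Rightarrow> real) \<Rightarrow> ('a \<Rightarrow> real) \<Rightarrow> real" where
  "ell2_norm B m f = sqrt (ell2_inner B m f f)"

definition ell_infinity :: "'a set \<Rightarrow> ('a \<Rightarrow> real) set" where
  "ell_infinity B = {f \<in> functions_on B. bounded (f ` B)}"


section \<open>Neumann form and Neumann Laplacian\<close>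

definition form_domain :: "'a set \<Rightarrow> ('a \<Rightarrow> 'a \<Rightarrow> real) \<Rightarrow> ('a \<Rightarrow> real) \<Rightarrow> ('a \<Rightarrow> real) set" where
  "form_domain V c m =
     {u \<in> ell2 V m. (\<lambda>(x, y). c x y * (u x - u y)\<^sup>2) summable_on V \<times> V}"

definition neumann_form :: "'a set \<Rightarrow> ('a \<Rightarrow> 'a \<Rightarrow> real) \<Rightarrow> ('a \<Rightarrow> real) \<Rightarrow> ('a \<Rightarrow> real) \<Rightarrow> real" where
  "neumann_form V c u v =
     1 / 2 * (\<Sum>\<^sub>\<infinity>(x, y)\<in>V \<times> V. c x y * (u x - u y) * (v x - v y))"

text \<open>The unbounded operator \<open>L\<close> is represented by its graph: \<open>(u, f)\<close> belongs to it iff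
  \<open>u \<in> D(L)\<close> and \<open>L u = f\<close>.\<close>

definition neumann_laplacian ::
    "'a set \<Rightarrow> ('a \<Rightarrow> 'a \<Rightarrow> real) \<Rightarrow> ('a \<Rightarrow> real) \<Rightarrow> (('a \<Rightarrow> real) \<times> ('a \<Rightarrow> real)) set" where
  "neumann_laplacian V c m =
     {(u, f). u \<in> form_domain V c m \<and> f \<in> ell2 V m
        \<and> (\<forall>v\<in>form_domain V c m. neumann_form V c u v = ell2_inner V m f v)}"

definition formal_laplacian ::
    "'a set \<Rightarrow> ('a \<Rightarrow> 'a \<Rightarrow> real) \<Rightarrow> ('a \<Rightarrow> real) \<Rightarrow> ('a \<Rightarrow> real) \<Rightarrow> 'a \<Rightarrow> real" where
  "formal_laplacian V c m f x = 1 / m x * (\<Sum>\<^sub>\<infinity>y\<in>V. c x y * (f x - f y))"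

definition Delta ::
    "'a set \<Rightarrow> ('a \<Rightarrow> 'a \<Rightarrow> real) \<Rightarrow> 'a set \<Rightarrow> ('a \<Rightarrow> real) \<Rightarrow> ('a \<Rightarrow> real) \<Rightarrow> 'a \<Rightarrow> real" where
  "Delta X b A m f x =
     (if x \<in> A then formal_laplacian (vertex_closure X b A) (induced_graph X b A) m f x else 0)"


section \<open>Normal derivative and Neumann problem\<close>

text \<open>The summability clause says that the pairing of \<open>\<Delta>\<^sub>A u\<close> with \<open>v\<close> is meaningful;
  \<open>infsum\<close> would otherwise silently be \<open>0\<close>.\<close>

definition is_normal_derivative ::
    "'a set \<Rightarrow> ('a \<Rightarrow> 'a \<Rightarrow> real) \<Rightarrow> 'a set \<Rightarrow> ('a \<Rightarrow> real) \<Rightarrow> ('a \<Rightarrow> real) \<Rightarrow> ('a \<Rightarrow> real) \<Rightarrow> bool" where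
  "is_normal_derivative X b A m u \<psi> \<longleftrightarrow>
     u \<in> form_domain (vertex_closure X b A) (induced_graph X b A) m
     \<and> \<psi> \<in> ell2 (vertex_boundary X b A) m
     \<and> (\<forall>v\<in>form_domain (vertex_closure X b A) (induced_graph X b A) m.
          (\<lambda>x. Delta X b A m u x * v x * m x) summable_on A
          \<and> neumann_form (vertex_closure X b A) (induced_graph X b A) u v
              - ell2_inner A m (Delta X b A m u) v
            = ell2_inner (vertex_boundary X b A) m \<psi> v)"

definition solves_neumann_problem ::
    "'a set \<Rightarrow> ('a \<Rightarrow> 'a \<Rightarrow> real) \<Rightarrow> 'a set \<Rightarrow> ('a \<Rightarrow> real) \<Rightarrow> ('a \<Rightarrow> real) \<Rightarrow> ('a \<Rightarrow> real) \<Rightarrow> bool" where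
  "solves_neumann_problem X b A m \<phi> u \<longleftrightarrow>
     u \<in> form_domain (vertex_closure X b A) (induced_graph X b A) m
     \<and> (\<forall>x\<in>A. Delta X b A m u x = 0)
     \<and> (\<exists>\<psi>. is_normal_derivative X b A m u \<psi> \<and> (\<forall>y\<in>vertex_boundary X b A. \<psi> y = \<phi> y))"


section \<open>The semigroup generated by a negative operator\<close>

definition c0_semigroup ::
    "'a set \<Rightarrow> ('a \<Rightarrow> real) \<Rightarrow> (real \<Rightarrow> ('a \<Rightarrow> real) \<Rightarrow> 'a \<Rightarrow> real) \<Rightarrow> bool" where
  "c0_semigroup V m T \<longleftrightarrow>
     (\<forall>t\<ge>0. \<forall>f\<in>ell2 V m. T t f \<in> ell2 V m)
     \<and> (\<forall>t\<ge>0. \<forall>f\<in>ell2 V m. \<forall>g\<in>ell2 V m. T t (\<lambda>x. f x + g x) = (\<lambda>x. T t f x + T t g x))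
     \<and> (\<forall>t\<ge>0. \<forall>f\<in>ell2 V m. \<forall>a. T t (\<lambda>x. a * f x) = (\<lambda>x. a * T t f x))
     \<and> (\<forall>t\<ge>0. \<exists>C. \<forall>f\<in>ell2 V m. ell2_norm V m (T t f) \<le> C * ell2_norm V m f)
     \<and> (\<forall>f\<in>ell2 V m. T 0 f = f)
     \<and> (\<forall>s\<ge>0. \<forall>t\<ge>0. \<forall>f\<in>ell2 V m. T (s + t) f = T s (T t f))
     \<and> (\<forall>f\<in>ell2 V m. ((\<lambda>t. ell2_norm V m (\<lambda>x. T t f x - f x)) \<longlongrightarrow> 0) (at_right 0))"

definition semigroup_generator ::
    "'a set \<Rightarrow> ('a \<Rightarrow> real) \<Rightarrow> (real \<Rightarrow> ('a \<Rightarrow> real) \<Rightarrow> 'a \<Rightarrow> real)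
      \<Rightarrow> (('a \<Rightarrow> real) \<times> ('a \<Rightarrow> real)) set" where
  "semigroup_generator V m T =
     {(u, w). u \<in> ell2 V m \<and> w \<in> ell2 V m
        \<and> ((\<lambda>t. ell2_norm V m (\<lambda>x. (T t u x - u x) / t - w x)) \<longlongrightarrow> 0) (at_right 0)}"

text \<open>
  For a nonnegative self-adjoint operator \<open>L\<close> on \<open>\<ell>\<^sup>2(V, m)\<close> (given by its graph), the family
  \<open>exp (- t L)\<close> from the functional calculus is the one and only strongly continuous semigroup
  whose generator is \<open>- L\<close>; this property is used to identify it.
\<close>

definition is_exp_semigroup ::
    "'a set \<Rightarrow> ('a \<Rightarrow> real) \<Rightarrow> (('a \<Rightarrow> real) \<times> ('a \<Rightarrow> real)) set
      \<Rightarrow> (real \<Rightarrow> ('a \<Rightarrow> real) \<Rightarrow> 'a \<Rightarrow> real) \<Rightarrow> bool" where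
  "is_exp_semigroup V m L T \<longleftrightarrow>
     c0_semigroup V m T \<and> semigroup_generator V m T = {(u, \<lambda>x. - f x) | u f. (u, f) \<in> L}"

definition ultracontractive ::
    "'a set \<Rightarrow> ('a \<Rightarrow> real) \<Rightarrow> (real \<Rightarrow> ('a \<Rightarrow> real) \<Rightarrow> 'a \<Rightarrow> real) \<Rightarrow> bool" where
  "ultracontractive V m T \<longleftrightarrow>
     (\<exists>\<gamma> :: real \<Rightarrow> real. (\<forall>t>0. 0 < \<gamma> t) \<and> antimono_on {0<..} \<gamma>
        \<and> (\<forall>t>0. \<forall>u\<in>ell2 V m. \<forall>x\<in>V. \<bar>T t u x\<bar> \<le> \<gamma> t * ell2_norm V m u))"

definition heat_kernel ::
    "('a \<Rightarrow> real) \<Rightarrow> (real \<Rightarrow> ('a \<Rightarrow> real) \<Rightarrow> 'a \<Rightarrow> real) \<Rightarrow> real \<Rightarrow> 'a \<Rightarrow> 'a \<Rightarrow> real" where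
  "heat_kernel m T t x y = 1 / m y * T t (indicat_real {y}) x"

definition green_kernel ::
    "'a set \<Rightarrow> ('a \<Rightarrow> real) \<Rightarrow> (real \<Rightarrow> ('a \<Rightarrow> real) \<Rightarrow> 'a \<Rightarrow> real) \<Rightarrow> 'a \<Rightarrow> 'a \<Rightarrow> real" where
  "green_kernel V m T x y =
     (LINT t:{0..}|lborel. heat_kernel m T t x y - 1 / (\<Sum>\<^sub>\<infinity>z\<in>V. m z))"


section \<open>The associated Markov process and its local time\<close>

text \<open>\<open>M\<close> carries the measurable space underlying the process; its measure is irrelevant.\<close>

definition natural_filtration :: "'a set \<Rightarrow> 'w measure \<Rightarrow> (real \<Rightarrow> 'w \<Rightarrow> 'a) \<Rightarrow> real \<Rightarrow> 'w measure" where
  "natural_filtration V M Y s =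
     sigma (space M) {Y r -` B \<inter> space M | r B. 0 \<le> r \<and> r \<le> s \<and> B \<subseteq> V}"

definition markov_process ::
    "'a set \<Rightarrow> 'w measure \<Rightarrow> ('a \<Rightarrow> 'w measure) \<Rightarrow> (real \<Rightarrow> 'w \<Rightarrow> 'a) \<Rightarrow> bool" where
  "markov_process V M P Y \<longleftrightarrow>
     (\<forall>x\<in>V. prob_space (P x) \<and> sets (P x) = sets M)
     \<and> (\<lambda>(t, \<omega>). Y t \<omega>) \<in> restrict_space borel {0..} \<Otimes>\<^sub>M M \<rightarrow>\<^sub>M count_space V
     \<and> (\<forall>x\<in>V. AE \<omega> in P x. Y 0 \<omega> = x)
     \<and> (\<forall>x\<in>V. \<forall>s\<ge>0. \<forall>t\<ge>0. \<forall>y\<in>V. AE \<omega> in P x.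
          real_cond_exp (P x) (natural_filtration V M Y s) (\<lambda>\<eta>. indicat_real {y} (Y (s + t) \<eta>)) \<omega>
          = measure (P (Y s \<omega>)) {\<eta> \<in> space M. Y t \<eta> = y})"

definition associated_process ::
    "'a set \<Rightarrow> ('a \<Rightarrow> real) \<Rightarrow> (real \<Rightarrow> ('a \<Rightarrow> real) \<Rightarrow> 'a \<Rightarrow> real)
      \<Rightarrow> 'w measure \<Rightarrow> ('a \<Rightarrow> 'w measure) \<Rightarrow> (real \<Rightarrow> 'w \<Rightarrow> 'a) \<Rightarrow> bool" where
  "associated_process V m T M P Y \<longleftrightarrow>
     markov_process V M P Y
     \<and> (\<forall>f\<in>ell2 V m. \<forall>t\<ge>0. \<forall>x\<in>V. has_bochner_integral (P x) (\<lambda>\<omega>. f (Y t \<omega>)) (T t f x))"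

definition local_time :: "'a set \<Rightarrow> (real \<Rightarrow> 'w \<Rightarrow> 'a) \<Rightarrow> real \<Rightarrow> 'w \<Rightarrow> real" where
  "local_time B Y t \<omega> = (LINT s:{0..t}|lborel. indicat_real B (Y s \<omega>))"

text \<open>The Lebesgue--Stieltjes integral of \<open>\<phi>(Y\<^sub>s)\<close> over \<open>[0, t]\<close> against the continuous
  nondecreasing function given by the local time (which is \<open>0\<close> at negative times).\<close>

definition local_time_integral ::
    "'a set \<Rightarrow> (real \<Rightarrow> 'w \<Rightarrow> 'a) \<Rightarrow> ('a \<Rightarrow> real) \<Rightarrow> real \<Rightarrow> 'w \<Rightarrow> real" where
  "local_time_integral B Y \<phi> t \<omega> =
     (LINT s:{0..t}|interval_measure (\<lambda>r. local_time B Y r \<omega>). \<phi> (Y s \<omega>))"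

end

theory Submission
  imports Defs "HOL-Real_Asymp.Real_Asymp"
begin

text \<open>
  Ultracontractivity and finiteness of \<open>m\<close> force a spectral gap: if mean-zero unit vectors
  \<open>u\<^sub>n\<close> in the domain had energies tending to \<open>0\<close>, then \<open>u\<^sub>n\<close> would be asymptotically constant by
  connectedness, and \<open>exp (- L) u\<^sub>n\<close> would be close to \<open>u\<^sub>n\<close> in norm, while being bounded pointwise
  independently of \<open>n\<close>; dominated convergence then makes \<open>exp (- L) u\<^sub>n\<close> converge to a constant of
  mean zero, contradicting the normalisation.

  Hence the semigroup decays exponentially on mean-zero functions, and the integral \<open>u\<close> of
  \<open>exp (- t L) \<phi>\<close> over \<open>[0, \<infinity>)\<close> exists and satisfies \<open>L u = \<phi>\<close>. Tested with indicators of points of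
  \<open>A\<close>, the weak equation \<open>Q(u, v) = \<langle>\<phi>, v\<rangle>\<close> says precisely that \<open>u\<close> solves the Neumann problem;
  connectedness gives uniqueness. The map from \<open>\<phi>\<close> to \<open>u\<close> is a bounded operator, so expanding \<open>\<phi>\<close>
  in indicators of points yields the Green kernel formula. The probabilistic formula is Fubini's
  theorem, as the local time has the indicator of the boundary along the path as its density.
\<close>

section \<open>The Hilbert space of square summable functions\<close>

text \<open>Functions on \<open>V\<close> form a carrier set, not a type, while derivatives, Cauchy
  limits and vector-valued integrals need a type of class \<open>banach\<close>. So everything is
  moved to an unweighted l2 type over all of \<open>'a\<close> by multiplying with the square root
  of \<open>m\<close>, and the semigroup is continued by the identity outside \<open>V\<close>; the
  spurious coordinates are cut away by orthogonality. No spectral theorem is invoked: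
  \<open>T\<close> is known only through its generator, so invariance of the mean, decay and
  displacement are obtained by differentiating along orbits that start in the domain. Where all
  vectors are needed, time averages of orbits, which lie in the domain, supply density. The
  closeness of exp (- L) u_n to u_n rests on such a derivative estimate with a free parameter
  \<epsilon> that trades energy against norm. The obstacle in the Green formula is that indicators
  of points do not have mean zero: the Green operator is therefore composed with the projection onto
  mean-zero functions, and this produces the constant subtracted in the Green kernel.\<close>

lemma summable_on_comparison_real:
  fixes f g :: "'a \<Rightarrow> real"
  assumes "f summable_on A" and "\<And>x. x \<in> A \<Longrightarrow> \<bar>g x\<bar> \<le> f x"
  shows "g summable_on A"
proof -
  have "(\<lambda>x. norm (g x)) summable_on A"
    by (rule Infinite_Sum.abs_summable_on_comparison_test'[OF assms(1)]) (simp add: assms(2))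
  thus ?thesis
    by (rule iffD2[OF summable_on_iff_abs_summable_on_real])
qed

lemma abs_mult_le_sum_squares: "\<bar>x * y\<bar> \<le> x\<^sup>2 + (y::real)\<^sup>2"
proof -
  have "0 \<le> (x + y)\<^sup>2 / 2 + (x\<^sup>2 + y\<^sup>2) / 2" "0 \<le> (x - y)\<^sup>2 / 2 + (x\<^sup>2 + y\<^sup>2) / 2"
    by simp_all
  thus ?thesis
    by (simp add: power2_sum power2_diff abs_le_iff field_simps)
qed

lemma square_add_le: "(x + y)\<^sup>2 \<le> 2 * x\<^sup>2 + 2 * (y::real)\<^sup>2"
  using zero_le_power2[of "x - y"] by (simp add: power2_eq_square algebra_simps)

lemma summable_on_add_square:
  fixes f g :: "'a \<Rightarrow> real"
  assumes "(\<lambda>x. (f x)\<^sup>2) summable_on A" "(\<lambda>x. (g x)\<^sup>2) summable_on A"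
  shows "(\<lambda>x. (f x + g x)\<^sup>2) summable_on A"
proof (rule summable_on_comparison_real)
  show "(\<lambda>x. 2 * (f x)\<^sup>2 + 2 * (g x)\<^sup>2) summable_on A"
    using assms by (intro summable_on_add summable_on_cmult_right)
qed (simp add: square_add_le)

text \<open>The type cannot depend on \<open>V\<close> and \<open>m\<close>, which are variables of
  the theorem; hence neither weight nor support appears here. Both enter through
  \<open>to_l2\<close> and \<open>of_l2\<close>.\<close>

typedef 'a l2 = "{f :: 'a \<Rightarrow> real. (\<lambda>x. (f x)\<^sup>2) summable_on UNIV}"
  morphisms coord Abs_l2
  by (rule exI[of _ "\<lambda>_. 0"]) simp

setup_lifting type_definition_l2

lemma coord_square_summable: "(\<lambda>x. (coord u x)\<^sup>2) summable_on UNIV"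
  using coord[of u] by simp

lemma coord_mult_summable: "(\<lambda>x. coord u x * coord v x) summable_on UNIV"
proof (rule summable_on_comparison_real)
  show "(\<lambda>x. (coord u x)\<^sup>2 + (coord v x)\<^sup>2) summable_on UNIV"
    by (intro summable_on_add coord_square_summable)
qed (rule abs_mult_le_sum_squares)

instantiation l2 :: (type) real_vector
begin

lift_definition zero_l2 :: "'a l2" is "\<lambda>_. 0" by simp
lift_definition plus_l2 :: "'a l2 \<Rightarrow> 'a l2 \<Rightarrow> 'a l2" is "\<lambda>f g x. f x + g x"
  by (rule summable_on_add_square)
lift_definition uminus_l2 :: "'a l2 \<Rightarrow> 'a l2" is "\<lambda>f x. - f x" by simp
lift_definition scaleR_l2 :: "real \<Rightarrow> 'a l2 \<Rightarrow> 'a l2" is "\<lambda>r f x. r * f x"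
  by (simp add: power_mult_distrib summable_on_cmult_right)
definition minus_l2 :: "'a l2 \<Rightarrow> 'a l2 \<Rightarrow> 'a l2" where "minus_l2 u v = u + - v"

instance
  by standard (unfold minus_l2_def, (transfer, simp add: fun_eq_iff algebra_simps)+)

end

instantiation l2 :: (type) real_inner
begin

lift_definition inner_l2 :: "'a l2 \<Rightarrow> 'a l2 \<Rightarrow> real" is "\<lambda>f g. \<Sum>\<^sub>\<infinity>x. f x * g x" .
definition norm_l2 :: "'a l2 \<Rightarrow> real" where "norm_l2 u = sqrt (inner u u)"
definition dist_l2 :: "'a l2 \<Rightarrow> 'a l2 \<Rightarrow> real" where "dist_l2 u v = norm (u - v)"
definition sgn_l2 :: "'a l2 \<Rightarrow> 'a l2" where "sgn_l2 u = inverse (norm u) *\<^sub>R u"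
definition uniformity_l2 :: "('a l2 \<times> 'a l2) filter" where
  "uniformity_l2 = (INF e\<in>{0<..}. principal {(u, v). dist u v < e})"
definition open_l2 :: "'a l2 set \<Rightarrow> bool" where
  "open_l2 U \<longleftrightarrow> (\<forall>u\<in>U. \<forall>\<^sub>F (u', v) in uniformity. u' = u \<longrightarrow> v \<in> U)"

instance
proof
  fix u v w :: "'a l2" and r :: real
  show "inner u v = inner v u"
    by transfer (simp add: mult.commute)
  show "inner (u + v) w = inner u w + inner v w"
    unfolding inner_l2.rep_eq plus_l2.rep_eq distrib_right
    by (rule infsum_add; rule coord_mult_summable)
  show "inner (r *\<^sub>R u) v = r * inner u v"
    unfolding inner_l2.rep_eq scaleR_l2.rep_eq
    by (simp add: mult.assoc infsum_cmult_right')
  show "0 \<le> inner u u"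
    unfolding inner_l2.rep_eq by (rule infsum_nonneg) simp
  show "inner u u = 0 \<longleftrightarrow> u = 0"
  proof
    assume "inner u u = 0"
    hence "(\<Sum>\<^sub>\<infinity>x. coord u x * coord u x) \<le> 0"
      by (simp add: inner_l2.rep_eq)
    hence "coord u x * coord u x = 0" for x
      by (rule nonneg_infsum_le_0D) (simp_all add: coord_mult_summable)
    thus "u = 0"
      by (simp add: coord_inject[symmetric] zero_l2.rep_eq fun_eq_iff)
  qed (simp add: inner_l2.rep_eq zero_l2.rep_eq)
qed (rule norm_l2_def dist_l2_def sgn_l2_def uniformity_l2_def open_l2_def)+

end

lemma coord_simps [simp]:
  "coord 0 x = 0" "coord (u + v) x = coord u x + coord v x"
  "coord (- u) x = - coord u x" "coord (r *\<^sub>R u) x = r * coord u x"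
  "coord (u - v) x = coord u x - coord v x"
  by (simp_all only: zero_l2.rep_eq plus_l2.rep_eq uminus_l2.rep_eq scaleR_l2.rep_eq
      minus_l2_def diff_conv_add_uminus[where 'a = real])

lemma l2_eqI: "(\<And>x. coord u x = coord v x) \<Longrightarrow> u = v"
  by (rule coord_inject[THEN iffD1]) (rule ext)

lemma norm_l2_square: "(norm u)\<^sup>2 = (\<Sum>\<^sub>\<infinity>x. (coord u x)\<^sup>2)"
  by (subst power2_norm_eq_inner, subst inner_l2.rep_eq, subst power2_eq_square) (rule refl)

lemma sum_square_le_norm_l2: "finite F \<Longrightarrow> (\<Sum>x\<in>F. (coord u x)\<^sup>2) \<le> (norm u)\<^sup>2"
  unfolding norm_l2_square by (rule finite_sum_le_infsum[OF coord_square_summable _ subset_UNIV zero_le_power2])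

lemma abs_coord_le_norm: "\<bar>coord u x\<bar> \<le> norm u"
proof (rule power2_le_imp_le)
  show "\<bar>coord u x\<bar>\<^sup>2 \<le> (norm u)\<^sup>2"
    using sum_square_le_norm_l2[of "{x}" u] by simp
qed simp

lemma bounded_linear_coord: "bounded_linear (\<lambda>u. coord u x)"
  by (rule bounded_linear_intro[where K = 1]) (simp_all add: abs_coord_le_norm)

lemma norm_l2_leI:
  assumes "\<And>F. finite F \<Longrightarrow> (\<Sum>x\<in>F. (coord u x)\<^sup>2) \<le> c\<^sup>2" "0 \<le> c"
  shows "norm u \<le> c"
proof -
  have "(norm u)\<^sup>2 \<le> c\<^sup>2"
    unfolding norm_l2_square by (rule infsum_le_finite_sums[OF coord_square_summable assms(1)])
  thus ?thesis using \<open>0 \<le> c\<close> power2_le_imp_le by blast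
qed

instance l2 :: (type) complete_space
proof
  fix X :: "nat \<Rightarrow> 'a l2"
  assume X: "Cauchy X"
  have "convergent (\<lambda>n. coord (X n) x)" for x
    using bounded_linear.Cauchy[OF bounded_linear_coord X] by (simp add: real_Cauchy_convergent)
  then obtain l where l: "\<And>x. (\<lambda>n. coord (X n) x) \<longlonglongrightarrow> l x"
    unfolding convergent_def by metis
  \<comment> \<open>One estimate serves twice: with \<open>v = 0\<close> it shows that the
    coordinatewise limit is square summable, with \<open>v = X n\<close> it bounds the distance of
    \<open>X n\<close> from that limit.\<close>
  have fatou: "(\<Sum>x\<in>F. (l x - coord v x)\<^sup>2) \<le> e\<^sup>2"
    if F: "finite F" and e: "\<And>n. N \<le> n \<Longrightarrow> norm (X n - v) \<le> e" for F v e N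
  proof (rule tendsto_upperbound)
    show "(\<lambda>n. \<Sum>x\<in>F. (coord (X n) x - coord v x)\<^sup>2) \<longlonglongrightarrow> (\<Sum>x\<in>F. (l x - coord v x)\<^sup>2)"
      by (intro tendsto_intros l)
    have "(\<Sum>x\<in>F. (coord (X n) x - coord v x)\<^sup>2) \<le> e\<^sup>2" if "N \<le> n" for n
      using sum_square_le_norm_l2[OF F, of "X n - v"] power_mono[OF e[OF that], of 2] by simp
    thus "\<forall>\<^sub>F n in sequentially. (\<Sum>x\<in>F. (coord (X n) x - coord v x)\<^sup>2) \<le> e\<^sup>2"
      by (auto simp: eventually_sequentially)
  qed simp
  obtain B where B: "\<And>n. norm (X n) \<le> B"
    using Cauchy_Bseq[OF X] by (auto simp: Bseq_def)
  have "(\<lambda>x. (l x)\<^sup>2) summable_on UNIV"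
  proof (rule nonneg_bdd_above_summable_on)
    show "bdd_above (sum (\<lambda>x. (l x)\<^sup>2) ` {F. F \<subseteq> UNIV \<and> finite F})"
      using fatou[of _ 0 0 B] B by (intro bdd_aboveI2[where M = "B\<^sup>2"]) simp
  qed simp
  then obtain u where u: "coord u = l"
    using Abs_l2_inverse by blast
  have "X \<longlonglongrightarrow> u"
  proof (rule LIMSEQ_I)
    fix r :: real assume "0 < r"
    then obtain N where N: "\<And>m n. m \<ge> N \<Longrightarrow> n \<ge> N \<Longrightarrow> norm (X m - X n) < r / 2"
      using X unfolding Cauchy_iff by (meson half_gt_zero)
    have "norm (X n - u) < r" if "N \<le> n" for n
    proof -
      have "norm (u - X n) \<le> r / 2"
      proof (rule norm_l2_leI)
        fix F :: "'a set" assume "finite F"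
        thus "(\<Sum>x\<in>F. (coord (u - X n) x)\<^sup>2) \<le> (r / 2)\<^sup>2"
          using fatou[of F N "X n" "r / 2"] N that by (auto simp: u less_imp_le)
      qed (use \<open>0 < r\<close> in simp)
      thus ?thesis using \<open>0 < r\<close> by (simp add: norm_minus_commute)
    qed
    thus "\<exists>N. \<forall>n\<ge>N. norm (X n - u) < r" by blast
  qed
  thus "convergent X" by (rule convergentI)
qed

instance l2 :: (type) banach ..

section \<open>The orthonormal basis of point vectors\<close>

definition point :: "'a \<Rightarrow> 'a l2" where "point x = Abs_l2 (indicat_real {x})"

lemma coord_point: "coord (point x) y = indicat_real {x} y"
proof -
  have "(\<lambda>y. (indicat_real {x} y)\<^sup>2) summable_on UNIV"
    by (rule finite_nonzero_values_imp_summable_on) (simp add: indicator_def)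
  thus ?thesis by (simp add: point_def Abs_l2_inverse)
qed

lemma inner_point: "inner u (point x) = coord u x"
proof -
  have "inner u (point x) = (\<Sum>\<^sub>\<infinity>y\<in>{x}. coord u y)"
    unfolding inner_l2.rep_eq by (rule infsum_cong_neutral) (auto simp: coord_point)
  thus ?thesis by simp
qed

text \<open>By orthonormality the squared distance of a partial sum from \<open>u\<close> is the
  squared norm minus a finite sum of squares, so summability of the squares gives convergence along
  all finite sets.\<close>

lemma has_sum_point: "((\<lambda>x. coord u x *\<^sub>R point x) has_sum u) UNIV"
proof -
  let ?s = "\<lambda>F. \<Sum>x\<in>F. coord u x *\<^sub>R point x"
  have coord_s: "coord (?s F) x = (if x \<in> F then coord u x else 0)" if "finite F" for F x
    using that by (induction F rule: finite_induct) (auto simp: coord_point indicator_def split: if_splits)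
  have norm_s: "norm (?s F - u) = sqrt ((norm u)\<^sup>2 - (\<Sum>x\<in>F. (coord u x)\<^sup>2))" if F: "finite F" for F
  proof -
    have inner_s: "inner v (?s F) = (\<Sum>x\<in>F. coord u x * coord v x)" for v
      by (simp add: inner_sum_right inner_point)
    have "inner (?s F - u) (?s F - u) = inner (?s F) (?s F) - 2 * inner u (?s F) + inner u u"
      by (simp add: inner_diff_left inner_diff_right inner_commute)
    also have "\<dots> = (norm u)\<^sup>2 - (\<Sum>x\<in>F. (coord u x)\<^sup>2)"
      unfolding inner_s using F
      by (simp add: coord_s power2_norm_eq_inner) (simp add: power2_eq_square)
    finally show ?thesis by (simp add: norm_eq_sqrt_inner)
  qed
  have "((\<lambda>x. (coord u x)\<^sup>2) has_sum (norm u)\<^sup>2) UNIV"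
    unfolding norm_l2_square by (rule has_sum_infsum[OF coord_square_summable])
  hence "((\<lambda>F. \<Sum>x\<in>F. (coord u x)\<^sup>2) \<longlongrightarrow> (norm u)\<^sup>2) (finite_subsets_at_top UNIV)"
    by (simp add: has_sum_def)
  hence "((\<lambda>F. sqrt ((norm u)\<^sup>2 - (\<Sum>x\<in>F. (coord u x)\<^sup>2)))
      \<longlongrightarrow> sqrt ((norm u)\<^sup>2 - (norm u)\<^sup>2)) (finite_subsets_at_top UNIV)"
    by (intro tendsto_intros)
  moreover have "\<forall>\<^sub>F F in finite_subsets_at_top UNIV.
      sqrt ((norm u)\<^sup>2 - (\<Sum>x\<in>F. (coord u x)\<^sup>2)) = norm (?s F - u)"
    by (rule eventually_finite_subsets_at_top_weakI) (simp add: norm_s)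
  ultimately have "((\<lambda>F. norm (?s F - u)) \<longlongrightarrow> sqrt ((norm u)\<^sup>2 - (norm u)\<^sup>2)) (finite_subsets_at_top UNIV)"
    by (rule Lim_transform_eventually)
  thus ?thesis
    by (simp add: has_sum_def tendsto_norm_zero_iff LIM_zero_iff)
qed

section \<open>Weighted square summable functions\<close>

text \<open>Dominated convergence for sums: a finite set carries the majorant \<open>r\<close> up to
  e / 2, and on a finite set pointwise convergence is enough.\<close>

lemma tendsto_infsum_dominated:
  fixes f :: "nat \<Rightarrow> 'a \<Rightarrow> real"
  assumes "r summable_on V" and "\<And>n x. x \<in> V \<Longrightarrow> \<bar>f n x\<bar> \<le> r x"
    and "\<And>x. x \<in> V \<Longrightarrow> (\<lambda>n. f n x) \<longlonglongrightarrow> 0"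
  shows "(\<lambda>n. \<Sum>\<^sub>\<infinity>x\<in>V. f n x) \<longlonglongrightarrow> 0"
proof (rule LIMSEQ_I)
  fix e :: real assume "0 < e"
  have "\<exists>F. finite F \<and> F \<subseteq> V \<and> dist (sum r F) (infsum r V) \<le> e / 2"
    by (rule infsum_finite_approximation[OF assms(1)]) (use \<open>0 < e\<close> in simp)
  then obtain F where F: "finite F" "F \<subseteq> V" and approx: "dist (sum r F) (infsum r V) \<le> e / 2"
    by blast
  have f_sum: "f n summable_on W" if "W \<subseteq> V" for n W
    by (rule summable_on_comparison_real[OF summable_on_subset_banach[OF assms(1) that]])
      (use that assms(2) in auto)
  have "infsum r V = sum r F + infsum r (V - F)"
    using infsum_Un_disjoint[of r F "V - F"] F summable_on_subset_banach[OF assms(1), of "V - F"]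
    by (simp add: Un_absorb1)
  hence tail: "infsum r (V - F) \<le> e / 2"
    using approx by (simp add: dist_real_def)
  have bound: "\<bar>\<Sum>\<^sub>\<infinity>x\<in>V. f n x\<bar> \<le> \<bar>\<Sum>x\<in>F. f n x\<bar> + e / 2" for n
  proof -
    have "infsum (f n) V = sum (f n) F + infsum (f n) (V - F)"
      using infsum_Un_disjoint[of "f n" F "V - F"] F f_sum[of "V - F" n] by (simp add: Un_absorb1)
    moreover have "norm (infsum (f n) (V - F)) \<le> infsum r (V - F)"
      using assms(2) by (intro norm_infsum_le[OF has_sum_infsum has_sum_infsum] f_sum
          summable_on_subset_banach[OF assms(1)]) auto
    ultimately show ?thesis using tail by simp
  qed
  have "(\<lambda>n. \<bar>\<Sum>x\<in>F. f n x\<bar>) \<longlonglongrightarrow> \<bar>\<Sum>x\<in>F. 0\<bar>"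
    using F assms(3) by (intro tendsto_intros) auto
  hence "\<forall>\<^sub>F n in sequentially. \<bar>\<Sum>x\<in>F. f n x\<bar> < e / 2"
    using \<open>0 < e\<close> by (intro order_tendstoD) auto
  then obtain N where N: "\<And>n. N \<le> n \<Longrightarrow> \<bar>\<Sum>x\<in>F. f n x\<bar> < e / 2"
    by (auto simp: eventually_sequentially)
  thus "\<exists>N. \<forall>n\<ge>N. norm ((\<Sum>\<^sub>\<infinity>x\<in>V. f n x) - 0) < e"
  proof (intro exI[of _ N] allI impI)
    fix n assume "N \<le> n"
    thus "norm ((\<Sum>\<^sub>\<infinity>x\<in>V. f n x) - 0) < e"
      using bound[of n] N[of n] by simp
  qed
qed

locale weighted_set =
  fixes V :: "'a set" and m :: "'a \<Rightarrow> real"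
  assumes finite_measure: "finite_discrete_measure V m"
begin

lemma weight_pos: "x \<in> V \<Longrightarrow> 0 < m x"
  using finite_measure by (simp add: finite_discrete_measure_def)

lemma sqrt_weight_nonzero: "x \<in> V \<Longrightarrow> sqrt (m x) \<noteq> 0"
  using weight_pos[of x] by simp

lemma weight_summable: "m summable_on V"
  using finite_measure by (simp add: finite_discrete_measure_def)

definition mass :: real where "mass = (\<Sum>\<^sub>\<infinity>x\<in>V. m x)"

lemma mass_nonneg: "0 \<le> mass"
  unfolding mass_def using weight_pos by (intro infsum_nonneg) (simp add: less_imp_le)

lemma mass_pos: "x \<in> V \<Longrightarrow> 0 < mass"
  unfolding mass_def
  using finite_sum_le_infsum[OF weight_summable, of "{x}"] weight_pos
  by (force simp: less_imp_le)

section \<open>The isometry from weighted to unweighted functions\<close>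

definition to_l2 :: "('a \<Rightarrow> real) \<Rightarrow> 'a l2" where
  "to_l2 f = Abs_l2 (\<lambda>x. if x \<in> V then f x * sqrt (m x) else 0)"

definition of_l2 :: "'a l2 \<Rightarrow> 'a \<Rightarrow> real" where
  "of_l2 u x = (if x \<in> V then coord u x / sqrt (m x) else 0)"

lemma coord_to_l2:
  assumes "f \<in> ell2 V m"
  shows "coord (to_l2 f) x = (if x \<in> V then f x * sqrt (m x) else 0)"
proof -
  have "(\<lambda>x. (f x)\<^sup>2 * m x) summable_on V"
    using assms by (simp add: ell2_def)
  also have "?this \<longleftrightarrow> (\<lambda>x. (if x \<in> V then f x * sqrt (m x) else 0)\<^sup>2) summable_on UNIV"
    by (rule summable_on_cong_neutral) (auto simp: power_mult_distrib weight_pos less_imp_le)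
  finally have "(\<lambda>x. (if x \<in> V then f x * sqrt (m x) else 0)\<^sup>2) summable_on UNIV" .
  thus ?thesis
    unfolding to_l2_def by (subst Abs_l2_inverse) simp_all
qed

lemma of_l2_in_ell2: "of_l2 u \<in> ell2 V m"
proof -
  have "(\<lambda>x. (coord u x)\<^sup>2) summable_on V"
    by (rule summable_on_subset_banach[OF coord_square_summable subset_UNIV])
  hence "(\<lambda>x. (of_l2 u x)\<^sup>2 * m x) summable_on V"
    by (rule summable_on_cong[THEN iffD1, rotated])
      (use weight_pos in \<open>force simp: of_l2_def power_divide less_imp_le\<close>)
  thus ?thesis
    by (simp add: ell2_def functions_on_def of_l2_def)
qed

lemma of_l2_to_l2:
  assumes "f \<in> ell2 V m"
  shows "of_l2 (to_l2 f) = f"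
proof
  fix x show "of_l2 (to_l2 f) x = f x"
    using assms sqrt_weight_nonzero[of x]
    by (cases "x \<in> V") (simp_all add: of_l2_def coord_to_l2 ell2_def functions_on_def)
qed

text \<open>\<open>of_l2\<close> forgets the coordinates outside \<open>V\<close>, so the two maps
  are inverse to each other in one order only; the other composition is the orthogonal projection
  onto the vectors supported in \<open>V\<close>.\<close>

lemma coord_to_l2_of_l2: "coord (to_l2 (of_l2 u)) x = (if x \<in> V then coord u x else 0)"
  using sqrt_weight_nonzero[of x] by (simp add: coord_to_l2[OF of_l2_in_ell2] of_l2_def)

lemma to_l2_of_l2: "(\<And>x. x \<notin> V \<Longrightarrow> coord u x = 0) \<Longrightarrow> to_l2 (of_l2 u) = u"
  by (rule l2_eqI) (simp add: coord_to_l2_of_l2)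

lemma of_l2_simps [simp]:
  "of_l2 (u + v) x = of_l2 u x + of_l2 v x"
  "of_l2 (u - v) x = of_l2 u x - of_l2 v x"
  "of_l2 (r *\<^sub>R u) x = r * of_l2 u x"
  "of_l2 (- u) x = - of_l2 u x"
  "of_l2 0 x = 0"
  by (simp_all add: of_l2_def add_divide_distrib diff_divide_distrib)

lemma ell2_combine:
  assumes "f \<in> ell2 V m" and "g \<in> ell2 V m"
  shows "(\<lambda>x. a * f x + b * g x) \<in> ell2 V m"
    and "to_l2 (\<lambda>x. a * f x + b * g x) = a *\<^sub>R to_l2 f + b *\<^sub>R to_l2 g"
proof -
  have eq: "(\<lambda>x. a * f x + b * g x) = of_l2 (a *\<^sub>R to_l2 f + b *\<^sub>R to_l2 g)"
    using assms by (simp add: fun_eq_iff of_l2_to_l2)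
  show "(\<lambda>x. a * f x + b * g x) \<in> ell2 V m"
    unfolding eq by (rule of_l2_in_ell2)
  show "to_l2 (\<lambda>x. a * f x + b * g x) = a *\<^sub>R to_l2 f + b *\<^sub>R to_l2 g"
    unfolding eq by (rule to_l2_of_l2) (simp add: coord_to_l2 assms)
qed

lemma to_l2_add: "f \<in> ell2 V m \<Longrightarrow> g \<in> ell2 V m \<Longrightarrow> to_l2 (\<lambda>x. f x + g x) = to_l2 f + to_l2 g"
  using ell2_combine(2)[of f g 1 1] by simp

lemma ell2_diff: "f \<in> ell2 V m \<Longrightarrow> g \<in> ell2 V m \<Longrightarrow> (\<lambda>x. f x - g x) \<in> ell2 V m"
  using ell2_combine(1)[of f g 1 "-1"] by simp

lemma to_l2_diff: "f \<in> ell2 V m \<Longrightarrow> g \<in> ell2 V m \<Longrightarrow> to_l2 (\<lambda>x. f x - g x) = to_l2 f - to_l2 g"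
  using ell2_combine(2)[of f g 1 "-1"] by simp

lemma to_l2_scale: "f \<in> ell2 V m \<Longrightarrow> to_l2 (\<lambda>x. a * f x) = a *\<^sub>R to_l2 f"
  using ell2_combine(2)[of f f a 0] by simp

lemma ell2_mult_has_sum:
  assumes "f \<in> ell2 V m" and "g \<in> ell2 V m"
  shows "((\<lambda>x. f x * g x * m x) has_sum inner (to_l2 f) (to_l2 g)) V"
proof -
  have "((\<lambda>x. coord (to_l2 f) x * coord (to_l2 g) x) has_sum inner (to_l2 f) (to_l2 g)) UNIV"
    unfolding inner_l2.rep_eq by (rule has_sum_infsum[OF coord_mult_summable])
  also have "?this \<longleftrightarrow> ?thesis"
  proof (rule has_sum_cong_neutral)
    fix x assume "x \<in> UNIV \<inter> V"
    hence "sqrt (m x) * sqrt (m x) = m x"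
      using weight_pos[of x] by simp
    moreover have "coord (to_l2 f) x * coord (to_l2 g) x = f x * g x * (sqrt (m x) * sqrt (m x))"
      using \<open>x \<in> UNIV \<inter> V\<close> assms by (simp add: coord_to_l2)
    ultimately show "coord (to_l2 f) x * coord (to_l2 g) x = f x * g x * m x"
      by simp
  qed (simp_all add: coord_to_l2 assms)
  finally show ?thesis .
qed

lemma ell2_inner_eq: "f \<in> ell2 V m \<Longrightarrow> g \<in> ell2 V m \<Longrightarrow> ell2_inner V m f g = inner (to_l2 f) (to_l2 g)"
  unfolding ell2_inner_def by (rule infsumI[OF ell2_mult_has_sum])

lemma ell2_norm_eq: "f \<in> ell2 V m \<Longrightarrow> ell2_norm V m f = norm (to_l2 f)"
  by (simp add: ell2_norm_def ell2_inner_eq norm_eq_sqrt_inner)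

lemma inner_of_l2:
  "(\<And>x. x \<notin> V \<Longrightarrow> coord v x = 0) \<Longrightarrow> ell2_inner V m (of_l2 u) (of_l2 v) = inner u v"
  unfolding ell2_inner_eq[OF of_l2_in_ell2 of_l2_in_ell2] inner_l2.rep_eq
  by (rule infsum_cong) (simp add: coord_to_l2_of_l2)

lemma norm_to_l2_of_l2_le: "norm (to_l2 (of_l2 u)) \<le> norm u"
proof (rule norm_l2_leI)
  fix F :: "'a set" assume F: "finite F"
  have "(\<Sum>x\<in>F. (coord (to_l2 (of_l2 u)) x)\<^sup>2) \<le> (\<Sum>x\<in>F. (coord u x)\<^sup>2)"
    by (intro sum_mono) (simp add: coord_to_l2_of_l2)
  also have "\<dots> \<le> (norm u)\<^sup>2"
    by (rule sum_square_le_norm_l2[OF F])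
  finally show "(\<Sum>x\<in>F. (coord (to_l2 (of_l2 u)) x)\<^sup>2) \<le> (norm u)\<^sup>2" .
qed simp

lemma bounded_linear_of_l2: "bounded_linear (\<lambda>u. of_l2 u x)"
proof (cases "x \<in> V")
  case True
  have "bounded_linear (\<lambda>u. coord u x * inverse (sqrt (m x)))"
    by (rule bounded_linear_mult_const[OF bounded_linear_coord])
  thus ?thesis using True by (simp add: of_l2_def divide_inverse)
qed (simp add: of_l2_def)

text \<open>Finite total mass embeds bounded functions in l2; together with ultracontractivity this
  bounds \<open>T t\<close> in norm uniformly for times away from 0. The absolute value covers a
  negative \<open>c\<close>, which is possible for empty \<open>V\<close>.\<close>

lemma bounded_in_ell2:
  assumes "f \<in> functions_on V" and "\<And>x. x \<in> V \<Longrightarrow> \<bar>f x\<bar> \<le> c"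
  shows "f \<in> ell2 V m" and "norm (to_l2 f) \<le> sqrt mass * \<bar>c\<bar>"
proof -
  have le: "(f x)\<^sup>2 * m x \<le> c\<^sup>2 * m x" if "x \<in> V" for x
    using assms(2)[OF that] weight_pos[OF that]
    by (intro mult_right_mono) (auto simp: abs_le_square_iff[symmetric])
  have "(\<lambda>x. (f x)\<^sup>2 * m x) summable_on V"
    by (rule summable_on_comparison_real[OF summable_on_cmult_right[OF weight_summable, of "c\<^sup>2"]])
      (use le weight_pos in \<open>simp add: abs_mult less_imp_le\<close>)
  thus f: "f \<in> ell2 V m"
    using assms(1) by (simp add: ell2_def)
  have "(norm (to_l2 f))\<^sup>2 = (\<Sum>\<^sub>\<infinity>x\<in>V. (f x)\<^sup>2 * m x)"
    unfolding power2_norm_eq_inner infsumI[OF ell2_mult_has_sum[OF f f], symmetric]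
    by (simp only: power2_eq_square)
  also have "\<dots> \<le> (\<Sum>\<^sub>\<infinity>x\<in>V. c\<^sup>2 * m x)"
    by (intro infsum_mono le summable_on_cmult_right weight_summable) fact
  also have "\<dots> = (sqrt mass * \<bar>c\<bar>)\<^sup>2"
    using mass_nonneg by (simp add: infsum_cmult_right' mass_def power_mult_distrib)
  finally show "norm (to_l2 f) \<le> sqrt mass * \<bar>c\<bar>"
    by (rule power2_le_imp_le) (simp add: mass_nonneg)
qed

lemma indicator_in_ell2: "B \<subseteq> V \<Longrightarrow> indicat_real B \<in> ell2 V m"
  by (rule bounded_in_ell2(1)[of _ 1]) (auto simp: functions_on_def indicator_def)

end

section \<open>The energy form of a graph\<close>

text \<open>The energy of an indicator of a point lives on the row and the column of
  \<open>V \<times> V\<close> through that point; this lemma and the next place a single sum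
  there.\<close>

lemma has_sum_single_row:
  assumes "(h has_sum s) V" and "x \<in> V"
  shows "((\<lambda>(z, y). if z = x then h y else 0) has_sum s) (V \<times> V)"
proof -
  have "((\<lambda>(z, y). if z = x then h y else 0) has_sum s) (V \<times> V)
      \<longleftrightarrow> ((\<lambda>(z, y). h y) has_sum s) (Pair x ` V)"
    using assms(2) by (intro has_sum_cong_neutral) (auto split: if_splits)
  also have "\<dots> \<longleftrightarrow> ((\<lambda>(z, y). h y) \<circ> Pair x has_sum s) V"
    by (rule has_sum_reindex) (auto simp: inj_on_def)
  finally show ?thesis using assms(1) by (simp add: o_def)
qed

lemma has_sum_single_column:
  assumes "(h has_sum s) V" and "x \<in> V"
  shows "((\<lambda>(z, y). if y = x then h z else 0) has_sum s) (V \<times> V)"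
proof -
  have "((\<lambda>(z, y). if y = x then h z else 0) has_sum s) (V \<times> V)
      \<longleftrightarrow> ((\<lambda>(z, y). h z) has_sum s) ((\<lambda>z. (z, x)) ` V)"
    using assms(2) by (intro has_sum_cong_neutral) (auto split: if_splits)
  also have "\<dots> \<longleftrightarrow> ((\<lambda>(z, y). h z) \<circ> (\<lambda>z. (z, x)) has_sum s) V"
    by (rule has_sum_reindex) (auto simp: inj_on_def)
  finally show ?thesis using assms(1) by (simp add: o_def)
qed

locale weighted_graph = weighted_set V m for V :: "'a set" and m +
  fixes c :: "'a \<Rightarrow> 'a \<Rightarrow> real"
  assumes c_nonneg: "x \<in> V \<Longrightarrow> y \<in> V \<Longrightarrow> 0 \<le> c x y"
    and c_commute: "x \<in> V \<Longrightarrow> y \<in> V \<Longrightarrow> c x y = c y x"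
    and c_summable: "x \<in> V \<Longrightarrow> (\<lambda>y. c x y) summable_on V"
    and connected: "connected_graph V c"
begin

text \<open>Carries a transitive relation from edges to all pairs. It is applied to exact constancy
  at zero energy and to asymptotic constancy along a sequence of vanishing energies.\<close>

lemma connected_induct [consumes 2, case_names edge trans]:
  assumes "x \<in> V" and "y \<in> V"
    and "\<And>x y. x \<in> V \<Longrightarrow> y \<in> V \<Longrightarrow> 0 < c x y \<Longrightarrow> R x y"
    and "\<And>x y z. R x y \<Longrightarrow> R y z \<Longrightarrow> R x z"
  shows "R x y"
proof -
  have "(x, y) \<in> {(z, w). z \<in> V \<and> w \<in> V \<and> 0 < c z w}\<^sup>+"
    using connected assms(1,2) unfolding connected_graph_def by blast
  thus ?thesis
    by (induction rule: trancl_induct) (use assms(3,4) in blast)+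
qed

lemma form_domain_ell2: "u \<in> form_domain V c m \<Longrightarrow> u \<in> ell2 V m"
  by (simp add: form_domain_def)

lemma energy_summable:
  "u \<in> form_domain V c m \<Longrightarrow> (\<lambda>(x, y). c x y * (u x - u y)\<^sup>2) summable_on V \<times> V"
  by (simp add: form_domain_def)

lemma form_summable:
  assumes "u \<in> form_domain V c m" and "v \<in> form_domain V c m"
  shows "(\<lambda>(x, y). c x y * (u x - u y) * (v x - v y)) summable_on V \<times> V"
proof (rule summable_on_comparison_real[OF summable_on_add[OF energy_summable[OF assms(1)] energy_summable[OF assms(2)]]])
  fix p assume "p \<in> V \<times> V"
  then obtain x y where p: "p = (x, y)" "0 \<le> c x y"
    using c_nonneg by (cases p) auto
  have "c x y * \<bar>(u x - u y) * (v x - v y)\<bar> \<le> c x y * ((u x - u y)\<^sup>2 + (v x - v y)\<^sup>2)"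
    using p(2) by (intro mult_left_mono abs_mult_le_sum_squares)
  thus "\<bar>case p of (x, y) \<Rightarrow> c x y * (u x - u y) * (v x - v y)\<bar>
      \<le> (case p of (x, y) \<Rightarrow> c x y * (u x - u y)\<^sup>2) + (case p of (x, y) \<Rightarrow> c x y * (v x - v y)\<^sup>2)"
    using p by (simp add: abs_mult distrib_left mult.assoc)
qed

lemma form_has_sum:
  assumes "u \<in> form_domain V c m" and "v \<in> form_domain V c m"
  shows "((\<lambda>(x, y). c x y * (u x - u y) * (v x - v y)) has_sum 2 * neumann_form V c u v) (V \<times> V)"
  using has_sum_infsum[OF form_summable[OF assms]] by (simp add: neumann_form_def)

lemma neumann_form_eqI:
  "((\<lambda>(x, y). c x y * (u x - u y) * (v x - v y)) has_sum 2 * q) (V \<times> V) \<Longrightarrow> neumann_form V c u v = q"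
  by (simp add: neumann_form_def infsumI)

lemma form_domainI:
  assumes "u \<in> ell2 V m" and "s summable_on V \<times> V"
    and "\<And>x y. x \<in> V \<Longrightarrow> y \<in> V \<Longrightarrow> c x y * (u x - u y)\<^sup>2 \<le> s (x, y)"
  shows "u \<in> form_domain V c m"
proof -
  have "(\<lambda>(x, y). c x y * (u x - u y)\<^sup>2) summable_on V \<times> V"
    by (rule summable_on_comparison_real[OF assms(2)]) (use assms(3) c_nonneg in \<open>auto simp: abs_mult\<close>)
  thus ?thesis using assms(1) by (simp add: form_domain_def)
qed

lemma form_domain_diff:
  assumes u: "u \<in> form_domain V c m" and v: "v \<in> form_domain V c m"
  shows "(\<lambda>x. u x - v x) \<in> form_domain V c m"
proof (rule form_domainI)
  show "(\<lambda>x. u x - v x) \<in> ell2 V m"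
    using assms by (intro ell2_diff form_domain_ell2)
  show "(\<lambda>p. 2 * (case p of (x, y) \<Rightarrow> c x y * (u x - u y)\<^sup>2)
      + 2 * (case p of (x, y) \<Rightarrow> c x y * (v x - v y)\<^sup>2)) summable_on V \<times> V"
    using assms by (intro summable_on_add summable_on_cmult_right energy_summable)
  fix x y assume "x \<in> V" "y \<in> V"
  hence "c x y * ((u x - u y) + (v y - v x))\<^sup>2 \<le> c x y * (2 * (u x - u y)\<^sup>2 + 2 * (v y - v x)\<^sup>2)"
    by (intro mult_left_mono square_add_le c_nonneg)
  moreover have "(u x - u y) + (v y - v x) = u x - v x - (u y - v y)" "(v y - v x)\<^sup>2 = (v x - v y)\<^sup>2"
    by (simp_all add: power2_commute)
  ultimately show "c x y * (u x - v x - (u y - v y))\<^sup>2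
      \<le> 2 * (case (x, y) of (x, y) \<Rightarrow> c x y * (u x - u y)\<^sup>2) + 2 * (case (x, y) of (x, y) \<Rightarrow> c x y * (v x - v y)\<^sup>2)"
    by (simp add: algebra_simps)
qed

lemma neumann_form_diff:
  assumes "u \<in> form_domain V c m" "u' \<in> form_domain V c m" "v \<in> form_domain V c m"
  shows "neumann_form V c (\<lambda>x. u x - u' x) v = neumann_form V c u v - neumann_form V c u' v"
proof (rule neumann_form_eqI)
  have "((\<lambda>p. (case p of (x, y) \<Rightarrow> c x y * (u x - u y) * (v x - v y))
      + - (case p of (x, y) \<Rightarrow> c x y * (u' x - u' y) * (v x - v y)))
      has_sum (2 * neumann_form V c u v + - (2 * neumann_form V c u' v))) (V \<times> V)"
    using assms by (intro has_sum_add form_has_sum has_sum_uminusI)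
  thus "((\<lambda>(x, y). c x y * (u x - u' x - (u y - u' y)) * (v x - v y))
      has_sum 2 * (neumann_form V c u v - neumann_form V c u' v)) (V \<times> V)"
    by (simp add: algebra_simps split_def)
qed

lemma neumann_form_commute: "neumann_form V c u v = neumann_form V c v u"
  by (simp add: neumann_form_def mult.assoc mult.commute[of "u _ - u _"])

lemma neumann_form_nonneg: "0 \<le> neumann_form V c u u"
  unfolding neumann_form_def
  by (intro mult_nonneg_nonneg infsum_nonneg) (auto simp: c_nonneg mult.assoc)

text \<open>A single term of a nonnegative sum. Each edge occurs in both orders, so the factor 2 is
  crude, but only the order of magnitude matters.\<close>

lemma edge_energy_le:
  assumes "u \<in> form_domain V c m" "x \<in> V" "y \<in> V"
  shows "c x y * (u x - u y)\<^sup>2 \<le> 2 * neumann_form V c u u"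
proof -
  have "sum (\<lambda>(x, y). c x y * (u x - u y) * (u x - u y)) {(x, y)} \<le> 2 * neumann_form V c u u"
    using assms c_nonneg
    by (intro finite_sum_le_has_sum[OF form_has_sum]) (auto simp: mult.assoc)
  thus ?thesis by (simp add: power2_eq_square mult.assoc)
qed

lemma neumann_form_eq_0_imp_const:
  assumes "u \<in> form_domain V c m" and "neumann_form V c u u = 0" and "x \<in> V" "y \<in> V"
  shows "u x = u y"
  using assms(3,4)
proof (induction rule: connected_induct)
  case (edge x y)
  hence "c x y * (u x - u y)\<^sup>2 \<le> 0"
    using edge_energy_le[OF assms(1) edge(1,2)] assms(2) by simp
  hence "(u x - u y)\<^sup>2 \<le> 0"
    using edge(3) by (simp add: mult_le_0_iff)
  thus ?case by simp
qed simp

section \<open>Constants and point indicators as test functions\<close>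

lemma one_in_form_domain: "indicat_real V \<in> form_domain V c m"
  by (rule form_domainI[of _ "\<lambda>_. 0"]) (auto simp: indicator_in_ell2)

lemma neumann_form_one: "neumann_form V c u (indicat_real V) = 0"
proof (rule neumann_form_eqI)
  have "((\<lambda>_. 0) has_sum (0::real)) (V \<times> V)" by simp
  also have "?this \<longleftrightarrow> ((\<lambda>(x, y). c x y * (u x - u y) * (indicat_real V x - indicat_real V y)) has_sum 0) (V \<times> V)"
    by (rule has_sum_cong) auto
  finally show "((\<lambda>(x, y). c x y * (u x - u y) * (indicat_real V x - indicat_real V y)) has_sum 2 * 0) (V \<times> V)"
    by simp
qed

text \<open>The indicator jumps only across edges at \<open>x\<close>, and their weights are
  summable. It is thus an admissible test function that localises a weak equation at
  \<open>x\<close>.\<close>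

lemma point_in_form_domain:
  assumes "x \<in> V"
  shows "indicat_real {x} \<in> form_domain V c m"
proof (rule form_domainI)
  show "indicat_real {x} \<in> ell2 V m"
    using assms by (intro indicator_in_ell2) simp
  show "(\<lambda>p. (case p of (z, y) \<Rightarrow> if z = x then c x y else 0)
      + (case p of (z, y) \<Rightarrow> if y = x then c x z else 0)) summable_on V \<times> V"
    using has_sum_single_row[OF has_sum_infsum[OF c_summable[OF assms]] assms]
      has_sum_single_column[OF has_sum_infsum[OF c_summable[OF assms]] assms]
    by (intro summable_on_add) (auto simp: summable_on_def)
  fix z y assume "z \<in> V" "y \<in> V"
  thus "c z y * (indicat_real {x} z - indicat_real {x} y)\<^sup>2
      \<le> (case (z, y) of (z, y) \<Rightarrow> if z = x then c x y else 0)
      + (case (z, y) of (z, y) \<Rightarrow> if y = x then c x z else 0)"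
    using c_nonneg[of z y] c_commute[of z y] by (auto simp: indicator_def)
qed

text \<open>Green's formula against a point: by symmetry of \<open>c\<close> the row and the column
  through \<open>x\<close> contribute equally, which cancels the factor 1/2 of the form.\<close>

lemma neumann_form_point:
  assumes u: "u \<in> form_domain V c m" and x: "x \<in> V"
  shows "neumann_form V c u (indicat_real {x}) = m x * formal_laplacian V c m u x"
proof (rule neumann_form_eqI)
  let ?h = "\<lambda>y. c x y * (u x - u y)"
  have "(\<lambda>(z, y). c z y * (u z - u y)\<^sup>2) summable_on Pair x ` V"
    using x by (intro summable_on_subset_banach[OF energy_summable[OF u]]) auto
  hence "((\<lambda>(z, y). c z y * (u z - u y)\<^sup>2) \<circ> Pair x) summable_on V"
    by (subst summable_on_reindex[symmetric]) (auto simp: inj_on_def)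
  hence "(\<lambda>y. c x y + c x y * (u x - u y)\<^sup>2) summable_on V"
    by (intro summable_on_add c_summable x) (simp add: o_def)
  \<comment> \<open>Finite energy controls only squares of differences;
    \<open>|s| \<le> 1 + s^2\<close>, weighted by the summable \<open>c x y\<close>, makes the
    differences themselves summable.\<close>
  moreover have "\<bar>?h y\<bar> \<le> c x y + c x y * (u x - u y)\<^sup>2" if "y \<in> V" for y
  proof -
    have "c x y * \<bar>1 * (u x - u y)\<bar> \<le> c x y * (1\<^sup>2 + (u x - u y)\<^sup>2)"
      by (intro mult_left_mono abs_mult_le_sum_squares c_nonneg x that)
    thus ?thesis using c_nonneg[OF x that] by (simp add: abs_mult distrib_left)
  qed
  ultimately have "?h summable_on V"
    by (rule summable_on_comparison_real)
  hence h: "(?h has_sum m x * formal_laplacian V c m u x) V"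
    using weight_pos[OF x] by (simp add: formal_laplacian_def)
  have "((\<lambda>p. (case p of (z, y) \<Rightarrow> if z = x then ?h y else 0)
      + (case p of (z, y) \<Rightarrow> if y = x then ?h z else 0))
      has_sum (m x * formal_laplacian V c m u x + m x * formal_laplacian V c m u x)) (V \<times> V)"
    by (intro has_sum_add has_sum_single_row has_sum_single_column h x)
  also have "?this \<longleftrightarrow> ((\<lambda>(z, y). c z y * (u z - u y) * (indicat_real {x} z - indicat_real {x} y))
      has_sum 2 * (m x * formal_laplacian V c m u x)) (V \<times> V)"
    unfolding mult_2
  proof (rule has_sum_cong)
    fix p assume "p \<in> V \<times> V"
    then obtain z y where p: "p = (z, y)" "c z y = c y z"
      using c_commute by (cases p) auto
    show "(case p of (z, y) \<Rightarrow> if z = x then ?h y else 0) + (case p of (z, y) \<Rightarrow> if y = x then ?h z else 0)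
      = (case p of (z, y) \<Rightarrow> c z y * (u z - u y) * (indicat_real {x} z - indicat_real {x} y))"
      using p by (auto simp: indicator_def algebra_simps)
  qed
  finally show "((\<lambda>(z, y). c z y * (u z - u y) * (indicat_real {x} z - indicat_real {x} y))
      has_sum 2 * (m x * formal_laplacian V c m u x)) (V \<times> V)" .
qed

end

section \<open>Strongly continuous semigroups on Hilbert spaces\<close>

lemma has_vector_derivative_iff_quotient:
  "(f has_vector_derivative d) (at x within S)
    \<longleftrightarrow> ((\<lambda>y. (f y - f x) /\<^sub>R (y - x)) \<longlongrightarrow> d) (at x within S)"
proof -
  have "norm (f y - f x - (y - x) *\<^sub>R d) / norm (y - x) = norm ((f y - f x) /\<^sub>R (y - x) - d)"
    if "y \<noteq> x" for y
  proof -
    have "f y - f x - (y - x) *\<^sub>R d = (y - x) *\<^sub>R ((f y - f x) /\<^sub>R (y - x) - d)"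
      using that by (simp add: scaleR_diff_right)
    thus ?thesis using that by simp
  qed
  hence "((\<lambda>y. norm (f y - f x - (y - x) *\<^sub>R d) / norm (y - x)) \<longlongrightarrow> 0) (at x within S)
    \<longleftrightarrow> ((\<lambda>y. norm ((f y - f x) /\<^sub>R (y - x) - d)) \<longlongrightarrow> 0) (at x within S)"
    by (intro filterlim_cong refl eventually_at_topological[THEN iffD2] exI[of _ UNIV]) auto
  thus ?thesis
    unfolding has_vector_derivative_def has_derivative_iff_norm
    by (simp add: bounded_linear_scaleR_left tendsto_norm_zero_iff LIM_zero_iff)
qed

text \<open>With step size |t - a| the right limits at 0 known for a semigroup yield two-sided
  limits at \<open>a\<close>.\<close>

lemma filterlim_abs_diff_at_right_0:
  "filterlim (\<lambda>t. \<bar>t - a\<bar>) (at_right 0) (at (a::real))"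
  unfolding filterlim_at
proof
  have "((\<lambda>t. \<bar>t - a\<bar>) \<longlongrightarrow> \<bar>a - a\<bar>) (at a)"
    by (intro tendsto_intros)
  thus "((\<lambda>t. \<bar>t - a\<bar>) \<longlongrightarrow> 0) (at a)" by simp
  show "\<forall>\<^sub>F t in at a. \<bar>t - a\<bar> \<in> {0<..} \<and> \<bar>t - a\<bar> \<noteq> 0"
    by (auto simp: eventually_at_filter)
qed

text \<open>The uniform bound on \<open>[a, \<infinity>)\<close>, which ultracontractivity provides directly, takes the place
  of the uniform boundedness principle.\<close>

locale strong_semigroup =
  fixes S :: "real \<Rightarrow> 'h \<Rightarrow> 'h::banach"
  assumes linear: "0 \<le> t \<Longrightarrow> bounded_linear (S t)"
    and zero [simp]: "S 0 u = u"
    and add: "0 \<le> s \<Longrightarrow> 0 \<le> t \<Longrightarrow> S (s + t) u = S s (S t u)"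
    and right_continuous_0: "((\<lambda>t. S t u) \<longlongrightarrow> u) (at_right 0)"
    and bounded_away_0: "0 < a \<Longrightarrow> \<exists>C. \<forall>t\<ge>a. \<forall>u. norm (S t u) \<le> C * norm u"
begin

text \<open>A relation rather than a partial function, like the operator graphs
  \<open>semigroup_generator\<close> and \<open>neumann_laplacian\<close> with which it is
  compared.\<close>

definition gen :: "'h \<Rightarrow> 'h \<Rightarrow> bool" where
  "gen u w \<longleftrightarrow> ((\<lambda>t. (S t u - u) /\<^sub>R t) \<longlongrightarrow> w) (at_right 0)"

lemma S_diff: "0 \<le> t \<Longrightarrow> S t (u - v) = S t u - S t v"
  by (rule linear_diff[OF bounded_linear.linear[OF linear]])

lemma S_scale: "0 \<le> t \<Longrightarrow> S t (r *\<^sub>R u) = r *\<^sub>R S t u"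
  by (rule linear_scale[OF bounded_linear.linear[OF linear]])

lemma gen_diff: "gen u w \<Longrightarrow> gen v z \<Longrightarrow> gen (u - v) (w - z)"
  unfolding gen_def
proof -
  assume "((\<lambda>t. (S t u - u) /\<^sub>R t) \<longlongrightarrow> w) (at_right 0)" "((\<lambda>t. (S t v - v) /\<^sub>R t) \<longlongrightarrow> z) (at_right 0)"
  hence "((\<lambda>t. (S t u - u) /\<^sub>R t - (S t v - v) /\<^sub>R t) \<longlongrightarrow> w - z) (at_right 0)"
    by (rule tendsto_diff)
  moreover have "\<forall>\<^sub>F t in at_right 0. (S t u - u) /\<^sub>R t - (S t v - v) /\<^sub>R t = (S t (u - v) - (u - v)) /\<^sub>R t"
    using eventually_at_right_less[of 0]
    by eventually_elim (simp add: S_diff scaleR_diff_right)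
  ultimately show "((\<lambda>t. (S t (u - v) - (u - v)) /\<^sub>R t) \<longlongrightarrow> w - z) (at_right 0)"
    by (rule Lim_transform_eventually)
qed

lemma gen_scale: "gen u w \<Longrightarrow> gen (r *\<^sub>R u) (r *\<^sub>R w)"
  unfolding gen_def
proof -
  assume "((\<lambda>t. (S t u - u) /\<^sub>R t) \<longlongrightarrow> w) (at_right 0)"
  hence "((\<lambda>t. r *\<^sub>R ((S t u - u) /\<^sub>R t)) \<longlongrightarrow> r *\<^sub>R w) (at_right 0)"
    by (intro tendsto_intros)
  moreover have "\<forall>\<^sub>F t in at_right 0. r *\<^sub>R ((S t u - u) /\<^sub>R t) = (S t (r *\<^sub>R u) - r *\<^sub>R u) /\<^sub>R t"
    using eventually_at_right_less[of 0]
    by eventually_elim (simp add: S_scale scaleR_diff_right mult.commute)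
  ultimately show "((\<lambda>t. (S t (r *\<^sub>R u) - r *\<^sub>R u) /\<^sub>R t) \<longlongrightarrow> r *\<^sub>R w) (at_right 0)"
    by (rule Lim_transform_eventually)
qed

section \<open>Continuity and differentiability of orbits\<close>

lemma isCont_orbit:
  assumes "0 < t"
  shows "isCont (\<lambda>t. S t u) t"
proof -
  obtain C where C: "\<And>s v. t / 2 \<le> s \<Longrightarrow> norm (S s v) \<le> C * norm v"
    using bounded_away_0[of "t / 2"] assms by auto
  \<comment> \<open>The operator at the smaller of the two times is split off. Both times are at
    least t / 2, so one constant \<open>C\<close> bounds it on either side of
    \<open>t\<close>.\<close>
  have "norm (S s u - S t u) \<le> C * norm (S \<bar>s - t\<bar> u - u)" if "t / 2 \<le> s" for s
  proof (cases "t \<le> s")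
    case True
    have "S s u = S t (S (s - t) u)"
      using add[of t "s - t" u] True assms by simp
    hence "S s u - S t u = S t (S (s - t) u - u)"
      using assms by (simp add: S_diff)
    thus ?thesis using C[of t "S (s - t) u - u"] True assms by simp
  next
    case False
    have "S t u = S s (S (t - s) u)"
      using add[of s "t - s" u] False that assms by simp
    hence "S s u - S t u = S s (u - S (t - s) u)"
      using assms that by (simp add: S_diff)
    thus ?thesis using C[of s "u - S (t - s) u"] False that by (simp add: norm_minus_commute)
  qed
  hence le: "\<forall>\<^sub>F s in at t. norm (S s u - S t u) \<le> C * norm (S \<bar>s - t\<bar> u - u)"
    using eventually_at_in_open'[of "{t / 2<..}" t] assms by (auto elim: eventually_mono)
  have "((\<lambda>s. S \<bar>s - t\<bar> u) \<longlongrightarrow> u) (at t)"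
    by (rule filterlim_compose[OF right_continuous_0 filterlim_abs_diff_at_right_0])
  hence "((\<lambda>s. C * norm (S \<bar>s - t\<bar> u - u)) \<longlongrightarrow> C * norm (u - u)) (at t)"
    by (intro tendsto_intros)
  hence "((\<lambda>s. S s u - S t u) \<longlongrightarrow> 0) (at t)"
    by (intro Lim_null_comparison[OF le]) simp
  thus ?thesis by (simp add: isCont_def LIM_zero_iff)
qed

lemma continuous_on_orbit: "continuous_on {0..} (\<lambda>t. S t u)"
  unfolding continuous_on_def
proof
  fix t :: real assume "t \<in> {0..}"
  show "((\<lambda>t. S t u) \<longlongrightarrow> S t u) (at t within {0..})"
  proof (cases "t = 0")
    case True
    thus ?thesis using right_continuous_0 by (simp add: at_within_Ici_at_right)
  next
    case False
    hence "0 < t" using False \<open>t \<in> {0..}\<close> by auto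
    thus ?thesis
      using isCont_orbit[of t u] tendsto_within_subset[OF _ subset_UNIV] unfolding isCont_def by blast
  qed
qed

text \<open>Joint continuity at positive times, needed for left difference quotients, where the
  operator and the vector vary together.\<close>

lemma tendsto_S:
  assumes "(f \<longlongrightarrow> w) F" and "(g \<longlongrightarrow> t) F" and "0 < t"
  shows "((\<lambda>x. S (g x) (f x)) \<longlongrightarrow> S t w) F"
proof -
  obtain C where C: "\<And>s v. t / 2 \<le> s \<Longrightarrow> norm (S s v) \<le> C * norm v"
    using bounded_away_0[of "t / 2"] assms by auto
  have "\<forall>\<^sub>F x in F. t / 2 < g x"
    using assms(2,3) by (intro order_tendstoD) auto
  hence "\<forall>\<^sub>F x in F. norm (S (g x) (f x) - S (g x) w) \<le> C * norm (f x - w)"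
  proof eventually_elim
    fix x assume "t / 2 < g x"
    thus "norm (S (g x) (f x) - S (g x) w) \<le> C * norm (f x - w)"
      using C[of "g x" "f x - w"] \<open>0 < t\<close> by (simp add: S_diff)
  qed
  moreover have "((\<lambda>x. C * norm (f x - w)) \<longlongrightarrow> C * norm (w - w)) F"
    using assms by (intro tendsto_intros)
  hence "((\<lambda>x. C * norm (f x - w)) \<longlongrightarrow> 0) F" by simp
  ultimately have "((\<lambda>x. S (g x) (f x) - S (g x) w) \<longlongrightarrow> 0) F"
    by (rule Lim_null_comparison)
  moreover have "((\<lambda>x. S (g x) w) \<longlongrightarrow> S t w) F"
    using isCont_orbit[OF \<open>0 < t\<close>] assms(2) by (rule isCont_tendsto_compose)
  ultimately have "((\<lambda>x. (S (g x) (f x) - S (g x) w) + S (g x) w) \<longlongrightarrow> 0 + S t w) F"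
    by (rule tendsto_add)
  thus ?thesis by simp
qed

lemma gen_orbit:
  assumes "gen u w" and "0 \<le> t"
  shows "gen (S t u) (S t w)"
proof -
  have "((\<lambda>h. S t ((S h u - u) /\<^sub>R h)) \<longlongrightarrow> S t w) (at_right 0)"
    using assms by (intro bounded_linear.tendsto[OF linear]) (auto simp: gen_def)
  moreover have "\<forall>\<^sub>F h in at_right 0. S t ((S h u - u) /\<^sub>R h) = (S h (S t u) - S t u) /\<^sub>R h"
    using eventually_at_right_less[of 0]
  proof eventually_elim
    fix h :: real assume "0 < h"
    have "S t (S h u) = S h (S t u)"
      using add[of t h u] add[of h t u] \<open>0 < h\<close> \<open>0 \<le> t\<close> by (simp add: add.commute)
    thus "S t ((S h u - u) /\<^sub>R h) = (S h (S t u) - S t u) /\<^sub>R h"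
      using \<open>0 \<le> t\<close> by (simp add: S_scale S_diff)
  qed
  ultimately show ?thesis
    unfolding gen_def by (rule Lim_transform_eventually)
qed

text \<open>The generator is only a right derivative at 0. The quotients on both sides of
  \<open>t\<close> have the form \<open>S (min s t)\<close> applied to the right quotient at 0 with
  step |s - t|, so one limit covers both sides.\<close>

lemma orbit_has_vector_derivative:
  assumes "gen u w" and "0 < t"
  shows "((\<lambda>t. S t u) has_vector_derivative S t w) (at t)"
proof -
  have "((\<lambda>s. S (min s t) ((S \<bar>s - t\<bar> u - u) /\<^sub>R \<bar>s - t\<bar>)) \<longlongrightarrow> S t w) (at t)"
  proof (rule tendsto_S)
    show "((\<lambda>s. (S \<bar>s - t\<bar> u - u) /\<^sub>R \<bar>s - t\<bar>) \<longlongrightarrow> w) (at t)"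
      using assms(1) unfolding gen_def by (rule filterlim_compose[OF _ filterlim_abs_diff_at_right_0])
    have "((\<lambda>s. min s t) \<longlongrightarrow> min t t) (at t)"
      by (intro tendsto_intros)
    thus "((\<lambda>s. min s t) \<longlongrightarrow> t) (at t)" by simp
  qed fact
  moreover have "\<forall>\<^sub>F s in at t. S (min s t) ((S \<bar>s - t\<bar> u - u) /\<^sub>R \<bar>s - t\<bar>) = (S s u - S t u) /\<^sub>R (s - t)"
    using eventually_at_in_open[of "{0<..}" t]  \<open>0 < t\<close>
  proof (simp, elim eventually_mono)
    fix s assume s: "0 < s \<and> s \<noteq> t"
    show "S (min s t) ((S \<bar>s - t\<bar> u - u) /\<^sub>R \<bar>s - t\<bar>) = (S s u - S t u) /\<^sub>R (s - t)"
    proof (cases "t \<le> s")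
      case True
      thus ?thesis
        using add[of t "s - t" u] \<open>0 < t\<close> by (simp add: S_scale S_diff)
    next
      case False
      hence "S (min s t) ((S \<bar>s - t\<bar> u - u) /\<^sub>R \<bar>s - t\<bar>) = (S t u - S s u) /\<^sub>R (t - s)"
        using add[of s "t - s" u] s by (simp add: S_scale S_diff)
      also have "\<dots> = (- (S s u - S t u)) /\<^sub>R (- (s - t))" by simp
      also have "\<dots> = (S s u - S t u) /\<^sub>R (s - t)"
        unfolding inverse_minus_eq scaleR_minus_left scaleR_minus_right by simp
      finally show ?thesis .
    qed
  qed
  ultimately show ?thesis
    unfolding has_vector_derivative_iff_quotient by (rule Lim_transform_eventually)
qed

section \<open>Time integrals of orbits\<close>

definition orbit_integral :: "real \<Rightarrow> real \<Rightarrow> 'h \<Rightarrow> 'h" where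
  "orbit_integral a b u = integral {a..b} (\<lambda>s. S s u)"

lemma orbit_integrable: "0 \<le> a \<Longrightarrow> (\<lambda>s. S s u) integrable_on {a..b}"
  by (intro integrable_continuous_interval continuous_on_subset[OF continuous_on_orbit]) auto

lemma bounded_linear_orbit_integral:
  "bounded_linear f \<Longrightarrow> 0 \<le> a \<Longrightarrow> f (orbit_integral a b u) = integral {a..b} (\<lambda>s. f (S s u))"
  unfolding orbit_integral_def
  by (subst integral_linear[OF orbit_integrable, symmetric]) (auto simp: o_def)

lemma orbit_integral_combine:
  "0 \<le> a \<Longrightarrow> a \<le> b \<Longrightarrow> b \<le> c \<Longrightarrow>
    orbit_integral a c u - orbit_integral a b u = orbit_integral b c u"
  unfolding orbit_integral_def
  using Henstock_Kurzweil_Integration.integral_combine[OF _ _ orbit_integrable, of a b c u] by (simp add: algebra_simps)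

text \<open>\<open>S h\<close> shifts the window of integration to [h, t + h]. The result is
  arranged as the increment at \<open>t\<close> minus the increment at 0: divided by
  \<open>h\<close> it gives the generator, and for large \<open>t\<close> only the second increment
  survives if the integral converges.\<close>

lemma S_orbit_integral:
  assumes "0 \<le> t" and "0 \<le> h"
  shows "S h (orbit_integral 0 t u) - orbit_integral 0 t u
    = (orbit_integral 0 (t + h) u - orbit_integral 0 t u) - orbit_integral 0 h u"
proof -
  have "S h (orbit_integral 0 t u) = integral {0..t} (\<lambda>s. S h (S s u))"
    using assms by (intro bounded_linear_orbit_integral linear) auto
  also have "\<dots> = integral {0..t} (\<lambda>s. S (s + h) u)"
    using assms by (intro integral_cong) (simp add: add[symmetric] add.commute)
  also have "\<dots> = orbit_integral h (t + h) u"
    unfolding orbit_integral_def using integral_shift_real_ivl[of h h "t + h" "\<lambda>s. S s u"] by simp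
  also have "\<dots> = orbit_integral 0 (t + h) u - orbit_integral 0 h u"
    using assms by (intro orbit_integral_combine[symmetric]) auto
  finally show ?thesis by simp
qed

lemma orbit_integral_right_derivative:
  assumes "0 \<le> t"
  shows "((\<lambda>h. (orbit_integral 0 (t + h) u - orbit_integral 0 t u) /\<^sub>R h) \<longlongrightarrow> S t u) (at_right 0)"
proof -
  have "((\<lambda>b. orbit_integral 0 b u) has_vector_derivative S t u) (at t within {0..t + 1})"
    unfolding orbit_integral_def using assms
    by (intro integral_has_vector_derivative continuous_on_subset[OF continuous_on_orbit]) auto
  hence "((\<lambda>b. orbit_integral 0 b u) has_vector_derivative S t u) (at t within {t..t + 1})"
    using assms by (auto intro: has_vector_derivative_within_subset)
  hence "((\<lambda>b. (orbit_integral 0 b u - orbit_integral 0 t u) /\<^sub>R (b - t)) \<longlongrightarrow> S t u) (at_right t)"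
    unfolding has_vector_derivative_iff_quotient
    by (simp add: at_within_Icc_at_right)
  thus ?thesis
    by (subst (asm) at_right_to_0) (simp add: filterlim_filtermap add.commute)
qed

lemma gen_orbit_integral:
  assumes "0 \<le> t"
  shows "gen (orbit_integral 0 t u) (S t u - u)"
proof -
  have "((\<lambda>h. (orbit_integral 0 (t + h) u - orbit_integral 0 t u) /\<^sub>R h
      - (orbit_integral 0 (0 + h) u - orbit_integral 0 0 u) /\<^sub>R h) \<longlongrightarrow> S t u - S 0 u) (at_right 0)"
    using assms by (intro tendsto_diff orbit_integral_right_derivative) auto
  moreover have "\<forall>\<^sub>F h in at_right 0.
      (orbit_integral 0 (t + h) u - orbit_integral 0 t u) /\<^sub>R h
      - (orbit_integral 0 (0 + h) u - orbit_integral 0 0 u) /\<^sub>R h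
      = (S h (orbit_integral 0 t u) - orbit_integral 0 t u) /\<^sub>R h"
    using eventually_at_right_less[of 0]
    by eventually_elim
      (simp add: S_orbit_integral assms scaleR_diff_right[symmetric], simp add: orbit_integral_def)
  ultimately show ?thesis
    unfolding gen_def using Lim_transform_eventually by fastforce
qed

text \<open>Together with \<open>gen_orbit_integral\<close> and \<open>gen_scale\<close> this is
  density of the domain of the generator.\<close>

lemma orbit_integral_average:
  "((\<lambda>h. orbit_integral 0 h u /\<^sub>R h) \<longlongrightarrow> u) (at_right 0)"
  using orbit_integral_right_derivative[of 0 u] by (simp add: orbit_integral_def)

end

lemma zero_derivative_imp_const:
  fixes k :: "real \<Rightarrow> real"
  assumes "continuous_on {0..} k" and "\<And>t. 0 < t \<Longrightarrow> (k has_real_derivative 0) (at t)" and "0 \<le> t"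
  shows "k t = k 0"
proof (cases "t = 0")
  case False
  thus ?thesis
    using assms by (intro DERIV_isconst_end continuous_on_subset[OF assms(1)]) auto
qed simp

text \<open>The vectors in \<open>E\<close> are annihilated by the adjoint of the generator, so their orthogonal
  complement is invariant. Exponential decay is only required on that complement.\<close>

locale hilbert_semigroup = strong_semigroup S for S :: "real \<Rightarrow> 'h \<Rightarrow> 'h::{real_inner, banach}" +
  fixes E :: "'h set"
  assumes gen_orthogonal: "gen u w \<Longrightarrow> e \<in> E \<Longrightarrow> inner w e = 0"
begin

definition complement :: "'h set" where
  "complement = {u. \<forall>e\<in>E. inner u e = 0}"

text \<open>On the domain the derivative is \<open>inner (S t w) e\<close>, which vanishes because
  \<open>S t w\<close> is again a value of the generator; averages extend this to every
  \<open>u\<close>.\<close>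

lemma inner_orbit_eq:
  assumes "0 \<le> t" and "e \<in> E"
  shows "inner (S t u) e = inner u e"
proof -
  have dom: "inner (S t v) e = inner v e" if v: "gen v w" for v w
  proof -
    have "(\<lambda>t. inner (S t v) e) t = (\<lambda>t. inner (S t v) e) 0"
    proof (rule zero_derivative_imp_const[OF _ _ assms(1)])
      show "continuous_on {0..} (\<lambda>t. inner (S t v) e)"
        by (intro continuous_intros continuous_on_orbit)
      fix t :: real assume t: "0 < t"
      have "((\<lambda>t. inner (S t v) e) has_vector_derivative inner (S t w) e) (at t)"
        by (intro bounded_linear.has_vector_derivative[OF bounded_linear_inner_left]
            orbit_has_vector_derivative v t)
      moreover have "inner (S t w) e = 0"
        using gen_orbit[OF v, of t] t assms(2) by (intro gen_orthogonal) auto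
      ultimately show "((\<lambda>t. inner (S t v) e) has_real_derivative 0) (at t)"
        by (simp add: has_real_derivative_iff_has_vector_derivative)
    qed
    thus ?thesis by simp
  qed
  let ?v = "\<lambda>h. orbit_integral 0 h u /\<^sub>R h"
  have lim: "((\<lambda>h. inner (S t (?v h)) e) \<longlongrightarrow> inner (S t u) e) (at_right 0)"
    by (intro tendsto_intros bounded_linear.tendsto[OF linear[OF assms(1)]] orbit_integral_average)
  have "\<forall>\<^sub>F h in at_right 0. inner (S t (?v h)) e = inner (?v h) e"
    using eventually_at_right_less[of 0]
  proof eventually_elim
    fix h :: real assume "0 < h"
    thus "inner (S t (?v h)) e = inner (?v h) e"
      by (intro dom[OF gen_scale[OF gen_orbit_integral]]) simp
  qed
  with lim have "((\<lambda>h. inner (?v h) e) \<longlongrightarrow> inner (S t u) e) (at_right 0)"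
    by (rule Lim_transform_eventually)
  moreover have "((\<lambda>h. inner (?v h) e) \<longlongrightarrow> inner u e) (at_right 0)"
    by (intro tendsto_intros orbit_integral_average)
  ultimately show ?thesis
    using tendsto_unique trivial_limit_at_right_real by blast
qed

lemma orbit_in_complement: "u \<in> complement \<Longrightarrow> 0 \<le> t \<Longrightarrow> S t u \<in> complement"
  by (simp add: complement_def inner_orbit_eq)

lemma orbit_integral_in_complement: "u \<in> complement \<Longrightarrow> orbit_integral 0 t u \<in> complement"
  unfolding complement_def
proof (intro CollectI ballI)
  fix e assume u: "u \<in> {u. \<forall>e\<in>E. inner u e = 0}" and e: "e \<in> E"
  have "inner (orbit_integral 0 t u) e = integral {0..t} (\<lambda>s. inner (S s u) e)"
    by (rule bounded_linear_orbit_integral[OF bounded_linear_inner_left]) simp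
  also have "\<dots> = integral {0..t} (\<lambda>s. 0)"
    using u e by (intro integral_cong) (simp add: inner_orbit_eq)
  finally show "inner (orbit_integral 0 t u) e = 0" by simp
qed

lemma scale_in_complement: "u \<in> complement \<Longrightarrow> r *\<^sub>R u \<in> complement"
  by (simp add: complement_def)

text \<open>A Gronwall argument: exp (2 \<kappa> s) times the squared norm has nonpositive
  derivative, as the orbit stays in the complement where the gap estimate holds. The sign of
  \<kappa> is free; \<kappa> = 0 turns dissipativity into contractivity.\<close>

lemma orbit_decay:
  assumes gap: "\<And>u w. gen u w \<Longrightarrow> u \<in> complement \<Longrightarrow> inner u w \<le> - \<kappa> * (norm u)\<^sup>2"
    and "u \<in> complement" and "0 \<le> t"
  shows "norm (S t u) \<le> exp (- \<kappa> * t) * norm u"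
proof -
  have dom: "norm (S t v) \<le> exp (- \<kappa> * t) * norm v" if v: "gen v w" "v \<in> complement" for v w
  proof -
    define k where "k s = exp (2 * \<kappa> * s) * inner (S s v) (S s v)" for s
    have "k t \<le> k 0"
    proof (rule DERIV_nonpos_imp_decreasing_open[OF \<open>0 \<le> t\<close>])
      show "continuous_on {0..t} k"
        unfolding k_def by (intro continuous_intros continuous_on_subset[OF continuous_on_orbit]) auto
      fix s :: real assume s: "0 < s" "s < t"
      note [derivative_intros] = bounded_bilinear.has_vector_derivative[OF bounded_bilinear_inner]
      have "((\<lambda>s. inner (S s v) (S s v)) has_vector_derivative
          inner (S s v) (S s w) + inner (S s w) (S s v)) (at s)"
        by (intro derivative_intros orbit_has_vector_derivative v s)
      hence "((\<lambda>s. inner (S s v) (S s v)) has_real_derivative 2 * inner (S s v) (S s w)) (at s)"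
        by (simp add: has_real_derivative_iff_has_vector_derivative inner_commute)
      hence "(k has_real_derivative exp (2 * \<kappa> * s) * (2 * inner (S s v) (S s w))
          + (exp (2 * \<kappa> * s) * (2 * \<kappa>)) * inner (S s v) (S s v)) (at s)"
        unfolding k_def by (auto intro!: derivative_eq_intros)
      moreover have "inner (S s v) (S s w) \<le> - \<kappa> * (norm (S s v))\<^sup>2"
        using s by (intro gap gen_orbit v orbit_in_complement) auto
      hence "exp (2 * \<kappa> * s) * (2 * (inner (S s v) (S s w) + \<kappa> * inner (S s v) (S s v))) \<le> 0"
        by (intro mult_nonneg_nonpos) (auto simp: power2_norm_eq_inner)
      ultimately show "\<exists>y. (k has_real_derivative y) (at s) \<and> y \<le> 0"
        by (intro exI conjI) (assumption, simp add: algebra_simps)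
    qed
    hence "(exp (\<kappa> * t) * norm (S t v))\<^sup>2 \<le> (norm v)\<^sup>2"
      by (simp add: k_def power_mult_distrib power2_norm_eq_inner exp_double[symmetric] mult.assoc)
    hence "exp (\<kappa> * t) * norm (S t v) \<le> norm v"
      by (rule power2_le_imp_le) simp
    thus ?thesis by (simp add: exp_minus field_simps)
  qed
  let ?v = "\<lambda>h. orbit_integral 0 h u /\<^sub>R h"
  show ?thesis
  proof (rule tendsto_le)
    show "((\<lambda>h. norm (S t (?v h))) \<longlongrightarrow> norm (S t u)) (at_right 0)"
      by (intro tendsto_intros bounded_linear.tendsto[OF linear[OF \<open>0 \<le> t\<close>]] orbit_integral_average)
    show "((\<lambda>h. exp (- \<kappa> * t) * norm (?v h)) \<longlongrightarrow> exp (- \<kappa> * t) * norm u) (at_right 0)"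
      by (intro tendsto_intros orbit_integral_average)
    show "\<forall>\<^sub>F h in at_right 0. norm (S t (?v h)) \<le> exp (- \<kappa> * t) * norm (?v h)"
      using eventually_at_right_less[of 0]
    proof eventually_elim
      fix h :: real assume "0 < h"
      thus "norm (S t (?v h)) \<le> exp (- \<kappa> * t) * norm (?v h)"
        by (intro dom[OF gen_scale[OF gen_orbit_integral]] scale_in_complement
            orbit_integral_in_complement assms) simp
    qed
  qed simp
qed

text \<open>Exponential decay makes the orbit integrals Cauchy. Their limit inverts the negated
  generator on the complement, and the norm estimate makes this inverse a bounded operator.\<close>

lemma resolvent_at_0:
  assumes gap: "\<And>u w. gen u w \<Longrightarrow> u \<in> complement \<Longrightarrow> inner u w \<le> - \<kappa> * (norm u)\<^sup>2"
    and "0 < \<kappa>" and u: "u \<in> complement"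
  obtains U where "gen U (- u)" and "U \<in> complement" and "norm U \<le> norm u / \<kappa>"
    and "((\<lambda>t. orbit_integral 0 t u) \<longlongrightarrow> U) at_top"
proof -
  let ?I = "\<lambda>t. orbit_integral 0 t u"
  have tail: "norm (?I b - ?I a) \<le> exp (- \<kappa> * a) * norm u / \<kappa>" if "0 \<le> a" "a \<le> b" for a b
  proof -
    have exp_int: "((\<lambda>s. exp (- \<kappa> * s) * norm u) has_integral exp (- \<kappa> * a) / \<kappa> * norm u) {a..}"
      by (intro has_integral_mult_left has_integral_exp_minus_to_infinity \<open>0 < \<kappa>\<close>)
    have exp_int': "(\<lambda>s. exp (- \<kappa> * s) * norm u) integrable_on {a..b}"
      by (intro integrable_continuous_interval continuous_intros)
    have "?I b - ?I a = integral {a..b} (\<lambda>s. S s u)"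
      using that by (simp add: orbit_integral_combine) (simp add: orbit_integral_def)
    also have "norm \<dots> \<le> integral {a..b} (\<lambda>s. exp (- \<kappa> * s) * norm u)"
      using that by (intro integral_norm_bound_integral orbit_integrable exp_int' orbit_decay gap u) auto
    also have "\<dots> \<le> integral {a..} (\<lambda>s. exp (- \<kappa> * s) * norm u)"
      by (intro integral_subset_le exp_int' has_integral_integrable[OF exp_int]) auto
    also have "\<dots> = exp (- \<kappa> * a) * norm u / \<kappa>"
      by (simp only: integral_unique[OF exp_int]) simp
    finally show ?thesis .
  qed
  have decay0: "((\<lambda>t. exp (- \<kappa> * t) * norm u / \<kappa>) \<longlongrightarrow> 0) at_top"
    using \<open>0 < \<kappa>\<close> by real_asymp
  \<comment> \<open>Completeness is used along integer times; the tail estimate then upgrades the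
    limit to all real times.\<close>
  have "Cauchy (\<lambda>n. ?I (real n))"
  proof (rule CauchyI')
    fix e :: real assume "0 < e"
    hence "\<forall>\<^sub>F t in at_top. exp (- \<kappa> * t) * norm u / \<kappa> < e"
      by (rule order_tendstoD(2)[OF decay0])
    then obtain T where T: "\<And>t. T \<le> t \<Longrightarrow> exp (- \<kappa> * t) * norm u / \<kappa> < e"
      by (auto simp: eventually_at_top_linorder)
    show "\<exists>N. \<forall>m\<ge>N. \<forall>n>m. dist (?I (real m)) (?I (real n)) < e"
    proof (intro exI allI impI)
      fix m n assume "nat \<lceil>T\<rceil> \<le> m" "m < n"
      thus "dist (?I (real m)) (?I (real n)) < e"
        using tail[of "real m" "real n"] T[of "real m"]
        by (simp add: dist_norm norm_minus_commute nat_ceiling_le_eq)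
    qed
  qed
  then obtain U where U: "(\<lambda>n. ?I (real n)) \<longlonglongrightarrow> U"
    using Cauchy_convergent convergent_def by blast
  have tail_U: "norm (U - ?I t) \<le> exp (- \<kappa> * t) * norm u / \<kappa>" if "0 \<le> t" for t
  proof (rule tendsto_upperbound)
    show "(\<lambda>n. norm (?I (real n) - ?I t)) \<longlonglongrightarrow> norm (U - ?I t)"
      by (intro tendsto_intros U)
    show "\<forall>\<^sub>F n in sequentially. norm (?I (real n) - ?I t) \<le> exp (- \<kappa> * t) * norm u / \<kappa>"
      using eventually_ge_at_top[of "nat \<lceil>t\<rceil>"]
      by eventually_elim (intro tail that, simp add: nat_ceiling_le_eq)
  qed simp
  have lim: "(?I \<longlongrightarrow> U) at_top"
  proof -
    have "((\<lambda>t. U - ?I t) \<longlongrightarrow> 0) at_top"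
      by (rule Lim_null_comparison[OF _ decay0])
        (rule eventually_mono[OF eventually_ge_at_top[of 0] tail_U])
    from tendsto_diff[OF tendsto_const[of U] this] show ?thesis by simp
  qed
  \<comment> \<open>The limit of \<open>S_orbit_integral\<close> for large times: the increment at
    \<open>t\<close> tends to 0 and the one at 0 remains.\<close>
  have S_U: "S h U - U = - ?I h" if "0 \<le> h" for h
  proof -
    have "((\<lambda>t. S h (?I t) - ?I t) \<longlongrightarrow> S h U - U) at_top"
      by (intro tendsto_intros bounded_linear.tendsto[OF linear[OF that]] lim)
    moreover have "((\<lambda>t. ?I (t + h) - ?I t - ?I h) \<longlongrightarrow> U - U - ?I h) at_top"
      by (intro tendsto_intros lim filterlim_compose[OF lim]) real_asymp
    moreover have "\<forall>\<^sub>F t in at_top. ?I (t + h) - ?I t - ?I h = S h (?I t) - ?I t"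
      using eventually_ge_at_top[of 0] by eventually_elim (simp add: S_orbit_integral that)
    ultimately have "((\<lambda>t. S h (?I t) - ?I t) \<longlongrightarrow> S h U - U) at_top"
      "((\<lambda>t. S h (?I t) - ?I t) \<longlongrightarrow> U - U - ?I h) at_top"
      by (simp_all only: filterlim_cong[OF refl refl])
    hence "S h U - U = U - U - ?I h"
      by (rule tendsto_unique[OF trivial_limit_at_top_linorder])
    thus ?thesis by simp
  qed
  show thesis
  proof
    have "((\<lambda>h. - (?I h /\<^sub>R h)) \<longlongrightarrow> - u) (at_right 0)"
      by (intro tendsto_intros orbit_integral_average)
    moreover have "\<forall>\<^sub>F h in at_right 0. - (?I h /\<^sub>R h) = (S h U - U) /\<^sub>R h"
      using eventually_at_right_less[of 0] by eventually_elim (simp add: S_U)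
    ultimately show "gen U (- u)"
      unfolding gen_def by (rule Lim_transform_eventually)
    have "inner U e = 0" if "e \<in> E" for e
    proof -
      have "((\<lambda>t. inner (?I t) e) \<longlongrightarrow> inner U e) at_top"
        by (intro tendsto_intros lim)
      moreover have "inner (?I t) e = 0" for t
        using orbit_integral_in_complement[OF u] that by (auto simp: complement_def)
      ultimately show ?thesis by (simp add: tendsto_const_iff)
    qed
    thus "U \<in> complement" by (simp add: complement_def)
    show "norm U \<le> norm u / \<kappa>"
      using tail_U[of 0] by (simp add: orbit_integral_def)
  qed (rule lim)
qed

text \<open>A scalar functional turns the limit of vector-valued gauge integrals into an absolutely
  convergent Lebesgue integral, dominated by the exponential decay.\<close>

lemma resolvent_functional:
  fixes f :: "'h \<Rightarrow> real"
  assumes gap: "\<And>u w. gen u w \<Longrightarrow> u \<in> complement \<Longrightarrow> inner u w \<le> - \<kappa> * (norm u)\<^sup>2"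
    and "0 < \<kappa>" and u: "u \<in> complement"
    and lim: "((\<lambda>t. orbit_integral 0 t u) \<longlongrightarrow> U) at_top" and f: "bounded_linear f"
  shows "has_bochner_integral (restrict_space lborel {0..}) (\<lambda>s. f (S s u)) (f U)"
proof -
  obtain K where K: "\<And>v. norm (f v) \<le> norm v * K"
    using bounded_linear.bounded[OF f] by blast
  have cont: "continuous_on {0..} (\<lambda>s. f (S s u))"
    by (intro bounded_linear.continuous_on[OF f] continuous_on_orbit)
  have "(\<lambda>s. exp (- \<kappa> * s)) integrable_on {0..}"
    using has_integral_exp_minus_to_infinity[OF \<open>0 < \<kappa>\<close>] by blast
  hence "set_integrable lebesgue {0..} (\<lambda>s. exp (- \<kappa> * s))"
    by (rule nonnegative_absolutely_integrable_1) simp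
  hence "set_integrable lborel {0..} (\<lambda>s. exp (- \<kappa> * s))"
    unfolding set_integrable_def by (subst (asm) integrable_completion) auto
  hence dom: "set_integrable lborel {0..} (\<lambda>s. exp (- \<kappa> * s) * (norm u * K))"
    by (rule set_integrable_mult_left)
  have "set_integrable lborel {0..} (\<lambda>s. f (S s u))"
    unfolding set_integrable_def
  proof (rule Bochner_Integration.integrable_bound)
    show "integrable lborel (\<lambda>s. indicat_real {0..} s *\<^sub>R (exp (- \<kappa> * s) * (norm u * K)))"
      using dom by (simp only: set_integrable_def)
    show "(\<lambda>s. indicat_real {0..} s *\<^sub>R f (S s u)) \<in> borel_measurable lborel"
      using borel_measurable_continuous_on_indicator[OF _ cont] by simp
    have bound: "\<bar>f (S s u)\<bar> \<le> \<bar>exp (- \<kappa> * s) * (norm u * K)\<bar>" if s: "0 \<le> s" for s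
    proof -
      \<comment> \<open>The operator bound comes without a sign. A nonzero vector forces
        \<open>K\<close> to be nonnegative; for \<open>u = 0\<close> both sides of the next estimate
        vanish.\<close>
      have "0 \<le> K" if "u \<noteq> 0"
        using K[of u] order_trans[OF norm_ge_zero K[of u]] that by (simp add: zero_le_mult_iff)
      hence "norm (S s u) * K \<le> exp (- \<kappa> * s) * norm u * K"
        using orbit_decay[OF gap u s] u by (cases "u = 0") (auto intro: mult_right_mono)
      thus ?thesis using K[of "S s u"] by (simp add: mult.assoc)
    qed
    show "AE s in lborel. norm (indicat_real {0..} s *\<^sub>R f (S s u))
        \<le> norm (indicat_real {0..} s *\<^sub>R (exp (- \<kappa> * s) * (norm u * K)))"
      using bound by (intro AE_I2) (auto simp: indicator_def)
  qed
  moreover have "(LINT s:{0..}|lborel. f (S s u)) = f U"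
  proof (rule tendsto_unique[OF trivial_limit_at_top_linorder])
    show "((\<lambda>t. LINT s:{0..t}|lborel. f (S s u)) \<longlongrightarrow> (LINT s:{0..}|lborel. f (S s u))) at_top"
      by (rule tendsto_set_lebesgue_integral_at_top) (simp_all add: calculation)
    have "(LINT s:{0..t}|lborel. f (S s u)) = f (orbit_integral 0 t u)" for t
    proof -
      have "set_integrable lborel {0..t} (\<lambda>s. f (S s u))"
        by (rule set_integrable_subset[OF calculation]) auto
      thus ?thesis
        by (simp add: set_borel_integral_eq_integral bounded_linear_orbit_integral[OF f])
    qed
    thus "((\<lambda>t. LINT s:{0..t}|lborel. f (S s u)) \<longlongrightarrow> f U) at_top"
      by (simp add: bounded_linear.tendsto[OF f lim])
  qed
  ultimately show ?thesis
    by (subst has_bochner_integral_restrict_space)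
      (simp_all add: has_bochner_integral_iff set_integrable_def set_lebesgue_integral_def)
qed

text \<open>Testing against every \<open>v\<close> reduces the claim to real functions with
  derivative 0. For the constant function it says that the semigroup is conservative.\<close>

lemma fixed_of_gen_zero:
  assumes "gen u 0" and "0 \<le> t"
  shows "S t u = u"
proof -
  have "(\<lambda>t. inner (S t u) v) t = (\<lambda>t. inner (S t u) v) 0" for v
  proof (rule zero_derivative_imp_const[OF _ _ assms(2)])
    show "continuous_on {0..} (\<lambda>t. inner (S t u) v)"
      by (intro continuous_intros continuous_on_orbit)
    fix t :: real assume t: "0 < t"
    have "((\<lambda>t. inner (S t u) v) has_vector_derivative inner (S t 0) v) (at t)"
      by (intro bounded_linear.has_vector_derivative[OF bounded_linear_inner_left]
          orbit_has_vector_derivative assms t)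
    thus "((\<lambda>t. inner (S t u) v) has_real_derivative 0) (at t)"
      using S_scale[of t 0 0] t by (simp add: has_real_derivative_iff_has_vector_derivative)
  qed
  hence "inner (S t u - u) (S t u - u) = 0"
    by (simp add: inner_diff_left del: inner_eq_zero_iff)
  thus ?thesis by simp
qed

text \<open>Dissipativity at \<open>\<epsilon> S\<^sub>s u - u\<close> replaces the Cauchy--Schwarz inequality for the form
  and bounds the derivative of \<open>inner (S s u) u\<close> from below.\<close>

lemma orbit_displacement:
  assumes dissipative: "\<And>u w. gen u w \<Longrightarrow> inner u w \<le> 0"
    and symmetric: "\<And>u w v z. gen u w \<Longrightarrow> gen v z \<Longrightarrow> inner u z = inner w v"
    and u: "gen u w" "u \<in> complement" and "0 < \<epsilon>"
  shows "(norm (S 1 u - u))\<^sup>2 \<le> - inner u w / \<epsilon> + \<epsilon> / 2 * (norm u)\<^sup>2"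
proof -
  define q where "q = - inner u w"
  \<comment> \<open>The coefficients come from the dissipativity inequality divided by 2 \<epsilon>.
    The squared norm differentiates to twice \<open>inner (S s u) (S s w)\<close>, hence \<epsilon>
    / 4; the derivative of \<open>k\<close> is then exactly the left side of that
    inequality.\<close>
  define k where "k s = \<epsilon> / 4 * inner (S s u) (S s u) - inner (S s u) u - s * (q / (2 * \<epsilon>))" for s
  have "k 1 \<le> k 0"
  proof (rule DERIV_nonpos_imp_decreasing_open[where a = 0 and b = 1 and f = k])
    show "continuous_on {0..1} k"
      unfolding k_def by (intro continuous_intros continuous_on_subset[OF continuous_on_orbit]) auto
    fix s :: real assume s: "0 < s" "s < 1"
    have "((\<lambda>s. inner (S s u) (S s u)) has_vector_derivative
        inner (S s u) (S s w) + inner (S s w) (S s u)) (at s)"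
      by (intro bounded_bilinear.has_vector_derivative[OF bounded_bilinear_inner]
          orbit_has_vector_derivative u s)
    hence d1: "((\<lambda>s. inner (S s u) (S s u)) has_real_derivative 2 * inner (S s u) (S s w)) (at s)"
      by (simp add: has_real_derivative_iff_has_vector_derivative inner_commute)
    have d2: "((\<lambda>s. inner (S s u) u) has_real_derivative inner (S s w) u) (at s)"
      unfolding has_real_derivative_iff_has_vector_derivative
      by (intro bounded_linear.has_vector_derivative[OF bounded_linear_inner_left]
            orbit_has_vector_derivative u s)
    have "(k has_real_derivative \<epsilon> / 4 * (2 * inner (S s u) (S s w)) - inner (S s w) u - q / (2 * \<epsilon>)) (at s)"
      unfolding k_def using \<open>0 < \<epsilon>\<close> by (auto intro!: derivative_eq_intros d1 d2)
    moreover have "\<epsilon> / 4 * (2 * inner (S s u) (S s w)) - inner (S s w) u - q / (2 * \<epsilon>) \<le> 0"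
    proof -
      have gen_s: "gen (S s u) (S s w)"
        using s by (intro gen_orbit u) simp
      have "inner (\<epsilon> *\<^sub>R S s u - u) (\<epsilon> *\<^sub>R S s w - w) \<le> 0"
        by (intro dissipative gen_diff gen_scale gen_s u)
      moreover have "inner (S s u) w = inner (S s w) u" "inner u (S s w) = inner (S s w) u"
        using symmetric[OF gen_s u(1)] by (simp_all add: inner_commute)
      ultimately have "\<epsilon> * (\<epsilon> * inner (S s u) (S s w)) - 2 * (\<epsilon> * inner (S s w) u) - q \<le> 0"
        by (simp add: inner_diff_left inner_diff_right q_def algebra_simps)
      hence "(\<epsilon> * (\<epsilon> * inner (S s u) (S s w)) - 2 * (\<epsilon> * inner (S s w) u) - q) / (2 * \<epsilon>) \<le> 0"
        using \<open>0 < \<epsilon>\<close> by (intro divide_nonpos_pos) auto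
      thus ?thesis using \<open>0 < \<epsilon>\<close> by (simp add: field_simps)
    qed
    ultimately show "\<exists>y. (k has_real_derivative y) (at s) \<and> y \<le> 0" by blast
  qed simp
  hence "(norm u)\<^sup>2 - inner (S 1 u) u \<le> q / (2 * \<epsilon>) + \<epsilon> / 4 * (norm u)\<^sup>2 - \<epsilon> / 4 * (norm (S 1 u))\<^sup>2"
    by (simp add: k_def power2_norm_eq_inner)
  also have "\<dots> \<le> q / (2 * \<epsilon>) + \<epsilon> / 4 * (norm u)\<^sup>2"
    using \<open>0 < \<epsilon>\<close> by simp
  finally have "2 * ((norm u)\<^sup>2 - inner (S 1 u) u) \<le> q / \<epsilon> + \<epsilon> / 2 * (norm u)\<^sup>2"
    by simp
  \<comment> \<open>Decay with rate 0. In the expanded square it replaces the squared norm of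
    \<open>S 1 u\<close> by that of \<open>u\<close>, leaving only the inner product of the
    two.\<close>
  moreover have "norm (S 1 u) \<le> norm u"
    using orbit_decay[of 0 u 1] dissipative u by simp
  hence "(norm (S 1 u))\<^sup>2 \<le> (norm u)\<^sup>2"
    by (intro power_mono) auto
  hence "(norm (S 1 u - u))\<^sup>2 \<le> 2 * ((norm u)\<^sup>2 - inner (S 1 u) u)"
    by (simp add: power2_norm_eq_inner inner_diff_left inner_diff_right inner_commute)
  ultimately show ?thesis by (simp add: q_def)
qed

end

section \<open>The Neumann semigroup\<close>

locale neumann_semigroup = weighted_graph V m c for V :: "'a set" and m c +
  fixes T :: "real \<Rightarrow> ('a \<Rightarrow> real) \<Rightarrow> 'a \<Rightarrow> real"
  assumes exp_semigroup: "is_exp_semigroup V m (neumann_laplacian V c m) T"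
    and ultra: "ultracontractive V m T"
begin

lemma T_ell2: "0 \<le> t \<Longrightarrow> f \<in> ell2 V m \<Longrightarrow> T t f \<in> ell2 V m"
  and T_add: "0 \<le> t \<Longrightarrow> f \<in> ell2 V m \<Longrightarrow> g \<in> ell2 V m \<Longrightarrow> T t (\<lambda>x. f x + g x) = (\<lambda>x. T t f x + T t g x)"
  and T_scale: "0 \<le> t \<Longrightarrow> f \<in> ell2 V m \<Longrightarrow> T t (\<lambda>x. a * f x) = (\<lambda>x. a * T t f x)"
  and T_0: "f \<in> ell2 V m \<Longrightarrow> T 0 f = f"
  and T_semigroup: "0 \<le> s \<Longrightarrow> 0 \<le> t \<Longrightarrow> f \<in> ell2 V m \<Longrightarrow> T (s + t) f = T s (T t f)"
  and T_continuous: "f \<in> ell2 V m \<Longrightarrow> ((\<lambda>t. ell2_norm V m (\<lambda>x. T t f x - f x)) \<longlongrightarrow> 0) (at_right 0)"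
  using exp_semigroup unfolding is_exp_semigroup_def c0_semigroup_def by auto

lemma T_bounded: "0 \<le> t \<Longrightarrow> \<exists>C. \<forall>f\<in>ell2 V m. ell2_norm V m (T t f) \<le> C * ell2_norm V m f"
  using exp_semigroup unfolding is_exp_semigroup_def c0_semigroup_def by auto

lemma ultracontractivity:
  obtains \<gamma> :: "real \<Rightarrow> real" where "\<And>t. 0 < t \<Longrightarrow> 0 < \<gamma> t" and "\<And>s t. 0 < s \<Longrightarrow> s \<le> t \<Longrightarrow> \<gamma> t \<le> \<gamma> s"
    and "\<And>t u x. 0 < t \<Longrightarrow> u \<in> ell2 V m \<Longrightarrow> x \<in> V \<Longrightarrow> \<bar>T t u x\<bar> \<le> \<gamma> t * ell2_norm V m u"
proof -
  obtain \<gamma> :: "real \<Rightarrow> real" where \<gamma>: "\<forall>t>0. 0 < \<gamma> t" "antimono_on {0<..} \<gamma>"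
    "\<forall>t>0. \<forall>u\<in>ell2 V m. \<forall>x\<in>V. \<bar>T t u x\<bar> \<le> \<gamma> t * ell2_norm V m u"
    using ultra unfolding ultracontractive_def by blast
  have "\<gamma> t \<le> \<gamma> s" if "0 < s" "s \<le> t" for s t
    using monotone_onD[OF \<gamma>(2), of s t] that by auto
  with \<gamma> show thesis by (intro that[of \<gamma>]) auto
qed

text \<open>\<open>T\<close> transported to the Hilbert space, acting as the identity outside \<open>V\<close>.\<close>

definition S :: "real \<Rightarrow> 'a l2 \<Rightarrow> 'a l2" where
  "S t u = u + (to_l2 (T t (of_l2 u)) - to_l2 (of_l2 u))"

definition one :: "'a l2" where "one = to_l2 (indicat_real V)"

lemma coord_to_l2_outside: "f \<in> ell2 V m \<Longrightarrow> x \<notin> V \<Longrightarrow> coord (to_l2 f) x = 0"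
  by (simp add: coord_to_l2)

lemma of_l2_S:
  assumes "0 \<le> t"
  shows "of_l2 (S t u) = T t (of_l2 u)"
  using assms by (simp add: fun_eq_iff S_def of_l2_to_l2 T_ell2 of_l2_in_ell2)

lemma S_to_l2: "f \<in> ell2 V m \<Longrightarrow> S t (to_l2 f) = to_l2 (T t f)"
  by (simp add: S_def of_l2_to_l2)

text \<open>Triangle inequality over the three terms defining \<open>S t\<close>: the identity and
  the subtracted restriction to \<open>V\<close> account for the 2. The sign of \<open>C\<close> is
  unknown, hence its absolute value.\<close>

lemma norm_S_le:
  assumes "0 \<le> t" "\<And>f. f \<in> ell2 V m \<Longrightarrow> norm (to_l2 (T t f)) \<le> C * norm (to_l2 f)"
  shows "norm (S t u) \<le> (2 + \<bar>C\<bar>) * norm u"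
proof -
  have "norm (to_l2 (T t (of_l2 u))) \<le> C * norm (to_l2 (of_l2 u))"
    by (intro assms of_l2_in_ell2)
  also have "\<dots> \<le> \<bar>C\<bar> * norm u"
    by (intro mult_mono norm_to_l2_of_l2_le) auto
  finally have "norm (to_l2 (T t (of_l2 u))) \<le> \<bar>C\<bar> * norm u" .
  moreover have "norm (S t u) \<le> norm u + (norm (to_l2 (T t (of_l2 u))) + norm (to_l2 (of_l2 u)))"
    unfolding S_def by (intro norm_triangle_le add_left_mono norm_triangle_ineq4)
  ultimately show ?thesis
    using norm_to_l2_of_l2_le[of u] by (simp add: algebra_simps)
qed

sublocale strong_semigroup S
proof (rule strong_semigroup.intro)
  fix t :: real assume t: "0 \<le> t"
  obtain C where C: "\<And>f. f \<in> ell2 V m \<Longrightarrow> ell2_norm V m (T t f) \<le> C * ell2_norm V m f"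
    using T_bounded[OF t] by blast
  show "bounded_linear (S t)"
  proof (rule bounded_linear_intro[where K = "2 + \<bar>C\<bar>"])
    fix u v :: "'a l2" and r :: real
    have "of_l2 (u + v) = (\<lambda>x. of_l2 u x + of_l2 v x)" by (simp add: fun_eq_iff)
    thus "S t (u + v) = S t u + S t v"
      using t by (simp add: S_def T_add to_l2_add T_ell2 of_l2_in_ell2)
    have "of_l2 (r *\<^sub>R u) = (\<lambda>x. r * of_l2 u x)" by (simp add: fun_eq_iff)
    thus "S t (r *\<^sub>R u) = r *\<^sub>R S t u"
      using t by (simp add: S_def T_scale to_l2_scale T_ell2 of_l2_in_ell2 algebra_simps)
    show "norm (S t u) \<le> norm u * (2 + \<bar>C\<bar>)"
      using norm_S_le[OF t, of C] C t by (simp add: ell2_norm_eq T_ell2 mult.commute)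
  qed
next
  show "S 0 u = u" for u
    by (simp add: S_def T_0 of_l2_in_ell2)
next
  fix s t :: real and u assume st: "0 \<le> s" "0 \<le> t"
  have "S s (S t u) = S t u + (to_l2 (T s (of_l2 (S t u))) - to_l2 (of_l2 (S t u)))"
    by (rule S_def)
  also have "\<dots> = S t u + (to_l2 (T (s + t) (of_l2 u)) - to_l2 (T t (of_l2 u)))"
    using st by (simp add: of_l2_S T_semigroup of_l2_in_ell2)
  finally show "S (s + t) u = S s (S t u)"
    by (simp add: S_def)
next
  fix u :: "'a l2"
  have "((\<lambda>t. S t u - u) \<longlongrightarrow> 0) (at_right 0)"
  proof (rule Lim_null_comparison)
    show "\<forall>\<^sub>F t in at_right 0. norm (S t u - u) \<le> ell2_norm V m (\<lambda>x. T t (of_l2 u) x - of_l2 u x)"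
      using eventually_at_right_less[of 0]
      by eventually_elim (simp add: S_def ell2_norm_eq ell2_diff to_l2_diff T_ell2 of_l2_in_ell2)
  qed (rule T_continuous[OF of_l2_in_ell2])
  thus "((\<lambda>t. S t u) \<longlongrightarrow> u) (at_right 0)"
    by (simp add: LIM_zero_iff)
next
  fix a :: real assume a: "0 < a"
  obtain \<gamma> :: "real \<Rightarrow> real" where \<gamma>: "\<And>t. 0 < t \<Longrightarrow> 0 < \<gamma> t" "\<And>s t. 0 < s \<Longrightarrow> s \<le> t \<Longrightarrow> \<gamma> t \<le> \<gamma> s"
    and bound: "\<And>t u x. 0 < t \<Longrightarrow> u \<in> ell2 V m \<Longrightarrow> x \<in> V \<Longrightarrow> \<bar>T t u x\<bar> \<le> \<gamma> t * ell2_norm V m u"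
    by (rule ultracontractivity) blast
  \<comment> \<open>The sup bound with \<open>\<gamma> t \<le> \<gamma> a\<close>, followed by the
    embedding of bounded functions in l2, gives one constant for all times from \<open>a\<close>
    on.\<close>
  have "norm (to_l2 (T t f)) \<le> sqrt mass * \<gamma> a * norm (to_l2 f)" if f: "f \<in> ell2 V m" and t: "a \<le> t" for f t
  proof -
    have "\<bar>T t f x\<bar> \<le> \<gamma> a * norm (to_l2 f)" if "x \<in> V" for x
    proof -
      have "\<bar>T t f x\<bar> \<le> \<gamma> t * norm (to_l2 f)"
        using bound[of t f x] a t f that by (simp add: ell2_norm_eq)
      also have "\<dots> \<le> \<gamma> a * norm (to_l2 f)"
        using \<gamma>(2)[OF a t] by (rule mult_right_mono) simp
      finally show ?thesis .
    qed
    hence "norm (to_l2 (T t f)) \<le> sqrt mass * \<bar>\<gamma> a * norm (to_l2 f)\<bar>"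
      using T_ell2[of t f] f a t by (intro bounded_in_ell2(2)) (auto simp: ell2_def)
    thus ?thesis using \<gamma>(1)[OF a] by (simp add: abs_mult mult.assoc)
  qed
  hence "norm (S t u) \<le> (2 + \<bar>sqrt mass * \<gamma> a\<bar>) * norm u" if "a \<le> t" for t u
    using a that by (intro norm_S_le) auto
  thus "\<exists>C. \<forall>t\<ge>a. \<forall>u. norm (S t u) \<le> C * norm u" by blast
qed

section \<open>The generator of the transported semigroup and the form\<close>

lemma S_minus_id: "0 \<le> t \<Longrightarrow> S t u - u = to_l2 (\<lambda>x. T t (of_l2 u) x - of_l2 u x)"
  by (simp add: S_def to_l2_diff T_ell2 of_l2_in_ell2)

text \<open>Difference quotients of \<open>S\<close> vanish where \<open>S\<close> acts as the
  identity. Passing from \<open>w\<close> to \<open>of_l2 w\<close> therefore loses nothing,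
  although \<open>u\<close> itself may have coordinates outside \<open>V\<close>.\<close>

lemma gen_outside:
  assumes "gen u w" and "x \<notin> V"
  shows "coord w x = 0"
proof -
  have "((\<lambda>t. coord ((S t u - u) /\<^sub>R t) x) \<longlongrightarrow> coord w x) (at_right 0)"
    using assms(1) unfolding gen_def by (rule bounded_linear.tendsto[OF bounded_linear_coord])
  moreover have "\<forall>\<^sub>F t in at_right 0. coord ((S t u - u) /\<^sub>R t) x = 0"
    using eventually_at_right_less[of 0]
    by eventually_elim
      (simp add: S_minus_id coord_to_l2_outside assms(2) ell2_diff T_ell2 of_l2_in_ell2 del: coord_simps(5))
  ultimately have "((\<lambda>t. 0) \<longlongrightarrow> coord w x) (at_right (0::real))"
    by (rule Lim_transform_eventually)
  thus ?thesis by (simp add: tendsto_const_iff)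
qed

lemma difference_quotient_norm:
  assumes "0 < t" and "\<And>x. x \<notin> V \<Longrightarrow> coord w x = 0"
  shows "ell2_norm V m (\<lambda>x. (T t (of_l2 u) x - of_l2 u x) / t - of_l2 w x) = norm ((S t u - u) /\<^sub>R t - w)"
proof -
  let ?d = "\<lambda>x. T t (of_l2 u) x - of_l2 u x"
  have d: "?d \<in> ell2 V m"
    using assms(1) by (intro ell2_diff T_ell2 of_l2_in_ell2) simp
  have eq: "(\<lambda>x. ?d x / t - of_l2 w x) = (\<lambda>x. inverse t * ?d x + (-1) * of_l2 w x)"
    by (simp add: fun_eq_iff divide_inverse)
  show ?thesis
    unfolding eq ell2_norm_eq[OF ell2_combine(1)[OF d of_l2_in_ell2]] ell2_combine(2)[OF d of_l2_in_ell2]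
    using assms by (simp add: S_minus_id to_l2_of_l2)
qed

text \<open>One half of the identification of the generator with the negated Laplacian; it makes the
  form available along orbits. The other half serves in \<open>gen_one\<close>.\<close>

lemma gen_imp_laplacian:
  assumes "gen u w"
  shows "(of_l2 u, of_l2 (- w)) \<in> neumann_laplacian V c m"
proof -
  have "((\<lambda>t. norm ((S t u - u) /\<^sub>R t - w)) \<longlongrightarrow> 0) (at_right 0)"
    using assms by (simp add: gen_def tendsto_norm_zero LIM_zero)
  moreover have "\<forall>\<^sub>F t in at_right 0. norm ((S t u - u) /\<^sub>R t - w)
      = ell2_norm V m (\<lambda>x. (T t (of_l2 u) x - of_l2 u x) / t - of_l2 w x)"
    using eventually_at_right_less[of 0]
    by eventually_elim (simp add: difference_quotient_norm gen_outside[OF assms])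
  ultimately have "((\<lambda>t. ell2_norm V m (\<lambda>x. (T t (of_l2 u) x - of_l2 u x) / t - of_l2 w x)) \<longlongrightarrow> 0) (at_right 0)"
    by (rule Lim_transform_eventually)
  hence "(of_l2 u, of_l2 w) \<in> semigroup_generator V m T"
    by (simp add: semigroup_generator_def of_l2_in_ell2)
  then obtain f where "(of_l2 u, f) \<in> neumann_laplacian V c m" "of_l2 w = (\<lambda>x. - f x)"
    using exp_semigroup unfolding is_exp_semigroup_def by auto
  moreover from this(2) have "of_l2 (- w) = f"
    by (simp add: fun_eq_iff)
  ultimately show ?thesis by simp
qed

lemma gen_form:
  assumes "gen u w"
  shows "of_l2 u \<in> form_domain V c m"
    and "v \<in> form_domain V c m \<Longrightarrow> neumann_form V c (of_l2 u) v = - inner w (to_l2 v)"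
proof -
  show "of_l2 u \<in> form_domain V c m"
    using gen_imp_laplacian[OF assms] by (simp add: neumann_laplacian_def)
  assume v: "v \<in> form_domain V c m"
  hence "neumann_form V c (of_l2 u) v = ell2_inner V m (of_l2 (- w)) v"
    using gen_imp_laplacian[OF assms] by (simp add: neumann_laplacian_def)
  also have "\<dots> = inner (to_l2 (of_l2 (- w))) (to_l2 v)"
    by (intro ell2_inner_eq of_l2_in_ell2 form_domain_ell2 v)
  also have "to_l2 (of_l2 (- w)) = - w"
    by (rule to_l2_of_l2) (simp add: gen_outside[OF assms])
  finally show "neumann_form V c (of_l2 u) v = - inner w (to_l2 v)" by simp
qed

text \<open>\<open>v\<close> may have coordinates outside \<open>V\<close>, but \<open>w\<close> has
  none, so the inner product does not see them. Dissipativity and symmetry of the generator both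
  follow from this formula.\<close>

lemma gen_inner_eq:
  assumes "gen u w" and "gen v z"
  shows "inner w v = - neumann_form V c (of_l2 u) (of_l2 v)"
proof -
  have "inner w v = (\<Sum>\<^sub>\<infinity>x. coord w x * coord (to_l2 (of_l2 v)) x)"
    unfolding inner_l2.rep_eq
    by (rule infsum_cong) (simp add: coord_to_l2_of_l2 gen_outside[OF assms(1)])
  also have "\<dots> = inner w (to_l2 (of_l2 v))"
    by (simp add: inner_l2.rep_eq)
  finally show ?thesis
    using gen_form(2)[OF assms(1) gen_form(1)[OF assms(2)]] by simp
qed

lemma gen_dissipative: "gen u w \<Longrightarrow> inner u w \<le> 0"
  using gen_inner_eq[of u w u w] neumann_form_nonneg by (simp add: inner_commute)

lemma gen_symmetric: "gen u w \<Longrightarrow> gen v z \<Longrightarrow> inner u z = inner w v"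
  using gen_inner_eq[of u w v z] gen_inner_eq[of v z u w]
    neumann_form_commute[of "of_l2 u" "of_l2 v"] by (simp add: inner_commute)

lemma gen_one: "gen one 0"
proof -
  have "(\<lambda>x. 0) \<in> ell2 V m"
    using bounded_in_ell2(1)[of "\<lambda>_. 0" 0] by (simp add: functions_on_def)
  hence "(indicat_real V, \<lambda>x. 0) \<in> neumann_laplacian V c m"
    using neumann_form_commute[of "indicat_real V"]
    by (simp add: neumann_laplacian_def one_in_form_domain neumann_form_one ell2_inner_def)
  hence "(indicat_real V, \<lambda>x. 0) \<in> semigroup_generator V m T"
    using exp_semigroup unfolding is_exp_semigroup_def by force
  hence "((\<lambda>t. ell2_norm V m (\<lambda>x. (T t (indicat_real V) x - indicat_real V x) / t - of_l2 0 x)) \<longlongrightarrow> 0) (at_right 0)"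
    by (simp add: semigroup_generator_def)
  moreover have "\<forall>\<^sub>F t in at_right 0. ell2_norm V m (\<lambda>x. (T t (indicat_real V) x - indicat_real V x) / t - of_l2 0 x)
      = norm ((S t one - one) /\<^sub>R t - 0)"
    using eventually_at_right_less[of 0]
    by eventually_elim
      (subst difference_quotient_norm[symmetric], simp_all add: one_def of_l2_to_l2 indicator_in_ell2)
  ultimately have "((\<lambda>t. norm ((S t one - one) /\<^sub>R t - 0)) \<longlongrightarrow> 0) (at_right 0)"
    by (rule Lim_transform_eventually)
  thus ?thesis
    by (simp only: gen_def tendsto_norm_zero_iff LIM_zero_iff)
qed

text \<open>Orthogonality to \<open>one\<close> means mean zero; orthogonality to the points outside
  \<open>V\<close> removes the coordinates on which \<open>S\<close> is the identity and cannot
  decay.\<close>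

sublocale hilbert_semigroup S "insert one (point ` (- V))"
proof
  fix u w e assume gen: "gen u w" and "e \<in> insert one (point ` (- V))"
  then consider "e = one" | x where "e = point x" "x \<notin> V" by auto
  thus "inner w e = 0"
  proof cases
    case 1
    thus ?thesis
      using gen_form(2)[OF gen one_in_form_domain] by (simp add: one_def neumann_form_one)
  next
    case 2
    thus ?thesis by (simp add: inner_point gen_outside[OF gen])
  qed
qed

lemma complement_iff: "u \<in> complement \<longleftrightarrow> inner u one = 0 \<and> (\<forall>x. x \<notin> V \<longrightarrow> coord u x = 0)"
  by (auto simp: complement_def inner_point)

lemma complement_to_l2_of_l2: "u \<in> complement \<Longrightarrow> to_l2 (of_l2 u) = u"
  by (rule to_l2_of_l2) (simp add: complement_iff)

lemma to_l2_in_complement: "f \<in> ell2 V m \<Longrightarrow> inner (to_l2 f) one = 0 \<Longrightarrow> to_l2 f \<in> complement"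
  by (simp add: complement_iff coord_to_l2)

end

section \<open>Spectral gap and Green operator\<close>

context neumann_semigroup
begin

lemma coord_one_outside: "x \<notin> V \<Longrightarrow> coord one x = 0"
  by (simp add: one_def coord_to_l2 indicator_in_ell2)

lemma spectral_gap: "\<exists>\<kappa>>0. \<forall>u w. gen u w \<longrightarrow> u \<in> complement \<longrightarrow> inner u w \<le> - \<kappa> * (norm u)\<^sup>2"
proof (rule ccontr)
  assume no_gap: "\<not> ?thesis"
  have unit: "\<exists>u w. gen u w \<and> u \<in> complement \<and> norm u = 1 \<and> - inner u w < \<kappa>" if pos: "0 < \<kappa>" for \<kappa>
  proof -
    obtain u w where u: "gen u w" "u \<in> complement" and lt: "- \<kappa> * (norm u)\<^sup>2 < inner u w"
    proof (atomize_elim)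
      have "\<not> (\<forall>u w. gen u w \<longrightarrow> u \<in> complement \<longrightarrow> inner u w \<le> - \<kappa> * (norm u)\<^sup>2)"
        using no_gap pos by blast
      thus "\<exists>u w. gen u w \<and> u \<in> complement \<and> - \<kappa> * (norm u)\<^sup>2 < inner u w"
        by (simp add: not_le)
    qed
    have "u \<noteq> 0" using lt by auto
    define r where "r = inverse (norm u)"
    have r: "r * norm u = 1" "0 < r"
      using \<open>u \<noteq> 0\<close> by (simp_all add: r_def)
    have "- inner (r *\<^sub>R u) (r *\<^sub>R w) = r\<^sup>2 * - inner u w"
      by (simp add: power2_eq_square)
    also have "\<dots> < r\<^sup>2 * (\<kappa> * (norm u)\<^sup>2)"
      using lt r(2) by (intro mult_strict_left_mono) auto
    also have "\<dots> = \<kappa> * (r * norm u)\<^sup>2"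
      by (simp add: power_mult_distrib)
    finally have "- inner (r *\<^sub>R u) (r *\<^sub>R w) < \<kappa>"
      using r(1) by simp
    moreover have "norm (r *\<^sub>R u) = 1"
      using r by simp
    ultimately show ?thesis
      using gen_scale[OF u(1), of r] scale_in_complement[OF u(2), of r] by blast
  qed
  define e where "e n = 1 / real (Suc n)" for n
  have e_pos: "0 < e n" for n by (simp add: e_def)
  have e_lim: "e \<longlonglongrightarrow> 0"
    unfolding e_def by (rule LIMSEQ_Suc[OF lim_const_over_n])
  \<comment> \<open>Energies below \<open>(e n)^2\<close> are chosen because
    \<open>orbit_displacement\<close>, applied with \<epsilon> equal to \<open>e n\<close>, divides
    the energy by \<open>e n\<close>; the quotient must still tend to 0.\<close>
  have "\<exists>u w. gen u w \<and> u \<in> complement \<and> norm u = 1 \<and> - inner u w < (e n)\<^sup>2" for n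
    using e_pos[of n] by (intro unit) simp
  then obtain u w where gen: "\<And>n. gen (u n) (w n)" and u: "\<And>n. u n \<in> complement"
    and u1: "\<And>n. norm (u n) = 1" and q: "\<And>n. - inner (u n) (w n) < (e n)\<^sup>2"
    by metis
  define v where "v n = S 1 (u n)" for n
  have disp: "(norm (v n - u n))\<^sup>2 \<le> 2 * e n" for n
  proof -
    have "(norm (v n - u n))\<^sup>2 \<le> - inner (u n) (w n) / e n + e n / 2 * (norm (u n))\<^sup>2"
      unfolding v_def
      by (rule orbit_displacement[OF gen_dissipative gen_symmetric gen u e_pos])
    also have "- inner (u n) (w n) / e n \<le> (e n)\<^sup>2 / e n"
      using q[of n] e_pos[of n] by (intro divide_right_mono) auto
    also have "(e n)\<^sup>2 / e n = e n"
      using e_pos[of n] by (simp add: power2_eq_square)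
    finally show ?thesis using u1[of n] e_pos[of n] by simp
  qed
  have "(\<lambda>n. (norm (v n - u n))\<^sup>2) \<longlonglongrightarrow> 0"
  proof (rule Lim_null_comparison)
    show "\<forall>\<^sub>F n in sequentially. norm ((norm (v n - u n))\<^sup>2) \<le> 2 * e n"
      using disp by simp
    show "(\<lambda>n. 2 * e n) \<longlonglongrightarrow> 0"
      using tendsto_mult_right_zero[OF e_lim] by simp
  qed
  hence v_u: "(\<lambda>n. v n - u n) \<longlonglongrightarrow> 0"
    by (simp add: tendsto_norm_zero_iff)
  \<comment> \<open>The base point exists because \<open>u 0\<close> has norm 1 and vanishes outside
    \<open>V\<close>.\<close>
  obtain a where a: "a \<in> V"
  proof (cases "V = {}")
    case True
    hence "x \<notin> V" for x by simp
    hence "coord (u 0) x = 0" for x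
      using u[of 0] unfolding complement_iff by blast
    hence "u 0 = 0" by (intro l2_eqI) simp
    thus ?thesis using u1[of 0] by simp
  qed auto
  have u_const: "(\<lambda>n. of_l2 (u n) x - of_l2 (u n) y) \<longlonglongrightarrow> 0" if "x \<in> V" "y \<in> V" for x y
    using that
  proof (induction rule: connected_induct)
    case (edge x y)
    have le: "c x y * (of_l2 (u n) x - of_l2 (u n) y)\<^sup>2 \<le> 2 * (e n)\<^sup>2" for n
      using edge_energy_le[OF gen_form(1)[OF gen] edge(1,2), of n] gen_inner_eq[OF gen gen, of n n] q[of n]
      by (simp add: inner_commute)
    have "(\<lambda>n. (of_l2 (u n) x - of_l2 (u n) y)\<^sup>2) \<longlonglongrightarrow> 0"
    proof (rule Lim_null_comparison)
      show "\<forall>\<^sub>F n in sequentially. norm ((of_l2 (u n) x - of_l2 (u n) y)\<^sup>2) \<le> 2 / c x y * (e n)\<^sup>2"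
        using le edge(3) by (simp add: field_simps)
      have "(\<lambda>n. 2 / c x y * (e n)\<^sup>2) \<longlonglongrightarrow> 2 / c x y * 0\<^sup>2"
        by (intro tendsto_intros e_lim)
      thus "(\<lambda>n. 2 / c x y * (e n)\<^sup>2) \<longlonglongrightarrow> 0" by simp
    qed
    thus ?case by simp
  next
    case (trans x y z)
    from tendsto_add[OF this] show ?case by simp
  qed
  \<comment> \<open>Norm convergence of \<open>v n - u n\<close> gives pointwise convergence, so
    asymptotic constancy passes to \<open>v\<close>. The exchange matters because ultracontractivity
    bounds \<open>v n\<close> pointwise, uniformly in n, and gives no such bound for
    \<open>u n\<close>.\<close>
  have v_const: "(\<lambda>n. of_l2 (v n) x - of_l2 (v n) a) \<longlonglongrightarrow> 0" if "x \<in> V" for x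
  proof -
    have "(\<lambda>n. of_l2 (v n - u n) x - of_l2 (v n - u n) a + (of_l2 (u n) x - of_l2 (u n) a))
        \<longlonglongrightarrow> of_l2 0 x - of_l2 0 a + 0"
      by (intro tendsto_intros bounded_linear.tendsto[OF bounded_linear_of_l2 v_u] u_const that a)
    thus ?thesis by simp
  qed
  obtain \<gamma> :: "real \<Rightarrow> real" where bound: "\<And>t f x. 0 < t \<Longrightarrow> f \<in> ell2 V m \<Longrightarrow> x \<in> V \<Longrightarrow> \<bar>T t f x\<bar> \<le> \<gamma> t * ell2_norm V m f"
    by (rule ultracontractivity) blast
  have v_bound: "\<bar>of_l2 (v n) x\<bar> \<le> \<gamma> 1" if "x \<in> V" for n x
    using bound[of 1 "of_l2 (u n)" x] that u1[of n] u[of n]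
    by (simp add: v_def of_l2_S of_l2_in_ell2 ell2_norm_eq complement_to_l2_of_l2)
  \<comment> \<open>The value at \<open>a\<close> stands in for the limiting constant and may vary
    with n; after subtracting it the functions tend to 0 pointwise and are bounded by
    \<open>2 * \<gamma> 1\<close>.\<close>
  let ?d = "\<lambda>n. v n - of_l2 (v n) a *\<^sub>R one"
  have d_eq: "of_l2 (?d n) x = of_l2 (v n) x - of_l2 (v n) a" if "x \<in> V" for n x
    using that by (simp add: one_def of_l2_to_l2 indicator_in_ell2)
  have "(\<lambda>n. \<Sum>\<^sub>\<infinity>x\<in>V. (of_l2 (?d n) x)\<^sup>2 * m x) \<longlonglongrightarrow> 0"
  proof (rule tendsto_infsum_dominated)
    show "(\<lambda>x. (2 * \<gamma> 1)\<^sup>2 * m x) summable_on V"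
      by (intro summable_on_cmult_right weight_summable)
    fix x assume x: "x \<in> V"
    show "\<bar>(of_l2 (?d n) x)\<^sup>2 * m x\<bar> \<le> (2 * \<gamma> 1)\<^sup>2 * m x" for n
    proof -
      have "\<bar>of_l2 (?d n) x\<bar> \<le> 2 * \<gamma> 1"
        unfolding d_eq[OF x] using v_bound[OF x, of n] v_bound[OF a, of n] by linarith
      hence "(of_l2 (?d n) x)\<^sup>2 \<le> (2 * \<gamma> 1)\<^sup>2"
        using power_mono[of "\<bar>of_l2 (?d n) x\<bar>" "2 * \<gamma> 1" 2] by simp
      thus ?thesis
        using weight_pos[OF x] by (simp only: abs_mult abs_power2 abs_of_pos mult_right_mono less_imp_le)
    qed
    have "(\<lambda>n. (of_l2 (v n) x - of_l2 (v n) a)\<^sup>2 * m x) \<longlonglongrightarrow> 0\<^sup>2 * m x"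
      by (intro tendsto_intros v_const x)
    thus "(\<lambda>n. (of_l2 (?d n) x)\<^sup>2 * m x) \<longlonglongrightarrow> 0"
      unfolding d_eq[OF x] by simp
  qed
  moreover have "(\<Sum>\<^sub>\<infinity>x\<in>V. (of_l2 (?d n) x)\<^sup>2 * m x) = (norm (?d n))\<^sup>2" for n
  proof -
    have "v n \<in> complement" unfolding v_def by (intro orbit_in_complement u) simp
    hence outside: "coord (?d n) x = 0" if "x \<notin> V" for x
      using that by (simp add: complement_iff coord_one_outside)
    have "ell2_inner V m (of_l2 (?d n)) (of_l2 (?d n)) = inner (?d n) (?d n)"
      by (rule inner_of_l2) (rule outside)
    thus ?thesis
      unfolding power2_norm_eq_inner ell2_inner_def by (simp only: power2_eq_square)
  qed
  ultimately have d_lim: "(\<lambda>n. (norm (?d n))\<^sup>2) \<longlonglongrightarrow> 0"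
    by simp
  have "(\<lambda>n. (norm (v n))\<^sup>2) \<longlonglongrightarrow> 0"
  proof (rule Lim_null_comparison[OF _ d_lim])
    \<comment> \<open>Pythagoras: \<open>v n\<close> is orthogonal to \<open>one\<close>, so
      subtracting a multiple of \<open>one\<close> cannot decrease the norm.\<close>
    have "(norm (v n))\<^sup>2 \<le> (norm (?d n))\<^sup>2" for n
    proof -
      have "inner (v n) one = 0"
        using orbit_in_complement[OF u, of 1 n] by (simp add: v_def complement_iff)
      hence "(norm (?d n))\<^sup>2 = (norm (v n))\<^sup>2 + (of_l2 (v n) a)\<^sup>2 * (norm one)\<^sup>2"
        unfolding power2_norm_eq_inner
        by (simp add: inner_diff_left inner_diff_right inner_commute power2_eq_square)
      thus ?thesis by simp
    qed
    thus "\<forall>\<^sub>F n in sequentially. norm ((norm (v n))\<^sup>2) \<le> (norm (?d n))\<^sup>2"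
      by simp
  qed
  hence "v \<longlonglongrightarrow> 0"
    by (simp add: tendsto_norm_zero_iff)
  from tendsto_diff[OF this v_u] have "u \<longlonglongrightarrow> 0" by simp
  hence "(\<lambda>n. norm (u n)) \<longlonglongrightarrow> 0" by (rule tendsto_norm_zero)
  thus False using u1 by (simp add: LIMSEQ_const_iff)
qed

section \<open>The Green operator on all vectors\<close>

definition gap :: real where
  "gap = (SOME \<kappa>. 0 < \<kappa> \<and> (\<forall>u w. gen u w \<longrightarrow> u \<in> complement \<longrightarrow> inner u w \<le> - \<kappa> * (norm u)\<^sup>2))"

lemma gap_pos: "0 < gap"
  and gap_le: "gen u w \<Longrightarrow> u \<in> complement \<Longrightarrow> inner u w \<le> - gap * (norm u)\<^sup>2"
  using someI_ex[OF spectral_gap, folded gap_def] by auto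

lemma inner_one: "f \<in> ell2 V m \<Longrightarrow> ((\<lambda>x. f x * m x) has_sum inner (to_l2 f) one) V"
  using ell2_mult_has_sum[of f "indicat_real V", folded one_def]
  by (simp add: indicator_in_ell2 cong: has_sum_cong)

lemma one_square: "inner one one = mass"
  using inner_one[of "indicat_real V"] infsumI
  by (fastforce simp: one_def indicator_in_ell2 mass_def cong: has_sum_cong)

text \<open>For nonempty \<open>V\<close>, the orthogonal projection onto \<open>complement\<close>:
  coordinates outside \<open>V\<close> are cut off and the mean is subtracted, \<open>mass\<close>
  being the squared norm of \<open>one\<close>.\<close>

definition projection :: "'a l2 \<Rightarrow> 'a l2" where
  "projection u = to_l2 (of_l2 u) - (inner u one / mass) *\<^sub>R one"

lemma projection_id: "u \<in> complement \<Longrightarrow> projection u = u"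
  by (simp add: projection_def complement_to_l2_of_l2 complement_iff)

lemma inner_to_l2_of_l2_one: "inner (to_l2 (of_l2 u)) one = inner u one"
  unfolding inner_l2.rep_eq
  by (rule infsum_cong) (simp add: coord_to_l2_of_l2 coord_one_outside)

lemma projection_in_complement:
  assumes "V \<noteq> {}"
  shows "projection u \<in> complement"
proof -
  have "mass \<noteq> 0" using assms mass_pos by force
  thus ?thesis
    by (simp add: complement_iff projection_def inner_diff_left inner_to_l2_of_l2_one one_square
        coord_to_l2_of_l2 coord_one_outside)
qed

lemma bounded_linear_projection: "bounded_linear projection"
proof -
  have "bounded_linear (\<lambda>u. to_l2 (of_l2 u))"
  proof (rule bounded_linear_intro[where K = 1])
    show "to_l2 (of_l2 (u + v)) = to_l2 (of_l2 u) + to_l2 (of_l2 v)" for u v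
      by (rule l2_eqI) (simp add: coord_to_l2_of_l2)
    show "to_l2 (of_l2 (r *\<^sub>R u)) = r *\<^sub>R to_l2 (of_l2 u)" for r u
      by (rule l2_eqI) (simp add: coord_to_l2_of_l2)
  qed (simp add: norm_to_l2_of_l2_le)
  moreover have "bounded_linear (\<lambda>u. (inner u one * inverse mass) *\<^sub>R one)"
    by (intro bounded_linear_scaleR_const bounded_linear_mult_const bounded_linear_inner_left)
  ultimately have "bounded_linear (\<lambda>u. to_l2 (of_l2 u) - (inner u one * inverse mass) *\<^sub>R one)"
    by (rule bounded_linear_sub)
  thus ?thesis
    by (simp add: projection_def[abs_def] divide_inverse)
qed

text \<open>The Green operator. Projecting before integrating makes the limit exist for every vector
  when \<open>V\<close> is nonempty, in particular for indicators of points.\<close>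

definition potential :: "'a l2 \<Rightarrow> 'a l2" where
  "potential u = Lim at_top (\<lambda>t. orbit_integral 0 t (projection u))"

context
  assumes nonempty: "V \<noteq> {}"
begin

lemma potential:
  shows gen_potential: "gen (potential u) (- projection u)"
    and potential_in_complement: "potential u \<in> complement"
    and norm_potential_le: "norm (potential u) \<le> norm (projection u) / gap"
    and potential_limit: "((\<lambda>t. orbit_integral 0 t (projection u)) \<longlongrightarrow> potential u) at_top"
proof -
  obtain U where U: "gen U (- projection u)" "U \<in> complement" "norm U \<le> norm (projection u) / gap"
    and lim: "((\<lambda>t. orbit_integral 0 t (projection u)) \<longlongrightarrow> U) at_top"
    using resolvent_at_0[OF gap_le gap_pos projection_in_complement[OF nonempty]] by metis
  have "potential u = U"
    unfolding potential_def by (rule tendsto_Lim[OF trivial_limit_at_top_linorder lim])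
  with U lim show "gen (potential u) (- projection u)" "potential u \<in> complement"
    "norm (potential u) \<le> norm (projection u) / gap"
    "((\<lambda>t. orbit_integral 0 t (projection u)) \<longlongrightarrow> potential u) at_top"
    by simp_all
qed

lemma potential_has_bochner_integral:
  "has_bochner_integral (restrict_space lborel {0..}) (\<lambda>s. of_l2 (S s (projection u)) x) (of_l2 (potential u) x)"
  by (rule resolvent_functional[OF gap_le gap_pos projection_in_complement[OF nonempty]
        potential_limit bounded_linear_of_l2])

text \<open>Linearity passes to the limit, and the spectral gap gives the bound. Boundedness is what
  allows the operator to be exchanged with an infinite sum.\<close>

lemma bounded_linear_potential: "bounded_linear potential"
proof -
  obtain K where K: "\<And>u. norm (projection u) \<le> norm u * K"
    using bounded_linear.bounded[OF bounded_linear_projection] by blast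
  have linear: "linear potential"
  proof
    fix u v :: "'a l2" and r :: real
    have add: "orbit_integral 0 t (projection (u + v)) = orbit_integral 0 t (projection u) + orbit_integral 0 t (projection v)" for t
    proof -
      have "orbit_integral 0 t (projection (u + v)) = integral {0..t} (\<lambda>s. S s (projection u) + S s (projection v))"
        unfolding orbit_integral_def
        by (intro integral_cong)
          (simp add: linear_add[OF bounded_linear.linear[OF bounded_linear_projection]]
            linear_add[OF bounded_linear.linear[OF linear]])
      also have "\<dots> = orbit_integral 0 t (projection u) + orbit_integral 0 t (projection v)"
        unfolding orbit_integral_def by (intro integral_add orbit_integrable) auto
      finally show ?thesis .
    qed
    show "potential (u + v) = potential u + potential v"
      using tendsto_add[OF potential_limit[of u] potential_limit[of v]]
      by (intro tendsto_unique[OF trivial_limit_at_top_linorder potential_limit]) (simp add: add)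
    have scale: "orbit_integral 0 t (projection (r *\<^sub>R u)) = r *\<^sub>R orbit_integral 0 t (projection u)" for t
    proof -
      have "orbit_integral 0 t (projection (r *\<^sub>R u)) = integral {0..t} (\<lambda>s. r *\<^sub>R S s (projection u))"
        unfolding orbit_integral_def
        by (intro integral_cong)
          (simp add: linear_scale[OF bounded_linear.linear[OF bounded_linear_projection]] S_scale)
      thus ?thesis
        by (simp add: orbit_integral_def)
    qed
    show "potential (r *\<^sub>R u) = r *\<^sub>R potential u"
      using tendsto_scaleR[OF tendsto_const potential_limit[of u], of r]
      by (intro tendsto_unique[OF trivial_limit_at_top_linorder potential_limit]) (simp add: scale)
  qed
  show ?thesis
  proof (rule bounded_linear_intro[where K = "K / gap"])
    show "norm (potential u) \<le> norm u * (K / gap)" for u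
      using norm_potential_le[of u] divide_right_mono[OF K[of u], of gap] gap_pos by simp
  qed (simp_all add: linear_add[OF linear] linear_scale[OF linear])
qed

end

section \<open>Expansions in the heat kernel and the Green kernel\<close>

lemma has_sum_to_l2:
  assumes f: "f \<in> ell2 V m"
  shows "((\<lambda>y. f y *\<^sub>R to_l2 (indicat_real {y})) has_sum to_l2 f) V"
proof -
  have "((\<lambda>y. coord (to_l2 f) y *\<^sub>R point y) has_sum to_l2 f) UNIV"
    by (rule has_sum_point)
  also have "?this \<longleftrightarrow> ?thesis"
  proof (rule has_sum_cong_neutral)
    fix y assume "y \<in> UNIV \<inter> V"
    hence "to_l2 (indicat_real {y}) = sqrt (m y) *\<^sub>R point y"
      by (intro l2_eqI) (auto simp: coord_to_l2 indicator_in_ell2 coord_point indicator_def)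
    thus "coord (to_l2 f) y *\<^sub>R point y = f y *\<^sub>R to_l2 (indicat_real {y})"
      using \<open>y \<in> UNIV \<inter> V\<close> by (simp add: coord_to_l2 f)
  qed (simp_all add: coord_to_l2 f)
  finally show ?thesis .
qed

text \<open>Applying the bounded operator \<open>S t\<close> and evaluation at \<open>x\<close>
  termwise to the expansion of \<open>f\<close> gives the heat kernel representation of
  \<open>T t f\<close>.\<close>

lemma T_has_sum:
  assumes "f \<in> ell2 V m" and "0 \<le> t"
  shows "((\<lambda>y. f y * T t (indicat_real {y}) x) has_sum T t f x) V"
proof -
  have lin: "bounded_linear (\<lambda>u. of_l2 (S t u) x)"
    using bounded_linear_compose[OF bounded_linear_of_l2 linear[OF assms(2)]] by (simp add: o_def)
  have "((\<lambda>y. of_l2 (S t (f y *\<^sub>R to_l2 (indicat_real {y}))) x) has_sum of_l2 (S t (to_l2 f)) x) V"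
    using has_sum_bounded_linear[OF lin has_sum_to_l2[OF assms(1)]] by (simp add: o_def)
  also have "?this \<longleftrightarrow> ?thesis"
    unfolding S_to_l2[OF assms(1)] of_l2_to_l2[OF T_ell2[OF assms(2,1)]]
    by (rule has_sum_cong) (simp add: S_scale of_l2_S of_l2_to_l2 indicator_in_ell2 assms(2))
  finally show ?thesis .
qed

lemma one_fixed: "0 \<le> t \<Longrightarrow> S t one = one"
  by (rule fixed_of_gen_zero[OF gen_one])

text \<open>The indicator of \<open>y\<close> has mean \<open>m y / mass\<close>, and constants are
  invariant under the semigroup. The projection thus subtracts, up to the factor \<open>m y\<close>,
  exactly the constant that the Green kernel subtracts from the heat kernel.\<close>

lemma potential_point:
  assumes x: "x \<in> V" and y: "y \<in> V"
  shows "of_l2 (potential (to_l2 (indicat_real {y}))) x = m y * green_kernel V m T x y"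
proof -
  have V: "V \<noteq> {}" using x by blast
  have ind: "indicat_real {y} \<in> ell2 V m"
    using y by (intro indicator_in_ell2) simp
  have "((\<lambda>z. indicat_real {y} z * m z) has_sum m y) V"
    by (rule has_sum_finite_neutralI[of "{y}"]) (use y in auto)
  hence inner: "inner (to_l2 (indicat_real {y})) one = m y"
    using inner_one[OF ind] has_sum_unique by blast
  have "of_l2 (S s (projection (to_l2 (indicat_real {y})))) x = m y * (heat_kernel m T s x y - 1 / (\<Sum>\<^sub>\<infinity>z\<in>V. m z))"
    if "0 \<le> s" for s
  proof -
    have "S s (projection (to_l2 (indicat_real {y}))) = S s (to_l2 (indicat_real {y})) - (m y / mass) *\<^sub>R one"
      using that by (simp add: projection_def inner S_diff S_scale one_fixed of_l2_to_l2 ind)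
    hence "of_l2 (S s (projection (to_l2 (indicat_real {y})))) x = T s (indicat_real {y}) x - m y / mass"
      using that x by (simp add: of_l2_S of_l2_to_l2 ind one_def indicator_in_ell2)
    thus ?thesis
      using weight_pos[OF y] by (simp add: heat_kernel_def mass_def right_diff_distrib)
  qed
  hence "(LINT s:{0..}|lborel. of_l2 (S s (projection (to_l2 (indicat_real {y})))) x)
      = (LINT s:{0..}|lborel. m y * (heat_kernel m T s x y - 1 / (\<Sum>\<^sub>\<infinity>z\<in>V. m z)))"
    by (intro set_lebesgue_integral_cong) auto
  also have "\<dots> = m y * green_kernel V m T x y"
    by (simp add: green_kernel_def)
  finally show ?thesis
    using potential_has_bochner_integral[OF V, of "to_l2 (indicat_real {y})" x]
    by (subst (asm) has_bochner_integral_restrict_space)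
      (simp_all add: has_bochner_integral_iff set_lebesgue_integral_def)
qed

lemma green_has_sum:
  assumes f: "f \<in> ell2 V m" and x: "x \<in> V"
  shows "((\<lambda>y. f y * green_kernel V m T x y * m y) has_sum of_l2 (potential (to_l2 f)) x) V"
proof -
  have "V \<noteq> {}" using x by blast
  hence lin: "bounded_linear (\<lambda>u. of_l2 (potential u) x)"
    using bounded_linear_compose[OF bounded_linear_of_l2 bounded_linear_potential] by (simp add: o_def)
  have "((\<lambda>y. of_l2 (potential (f y *\<^sub>R to_l2 (indicat_real {y}))) x) has_sum of_l2 (potential (to_l2 f)) x) V"
    using has_sum_bounded_linear[OF lin has_sum_to_l2[OF f]] by (simp add: o_def)
  also have "?this \<longleftrightarrow> ?thesis"
    by (rule has_sum_cong)
      (simp add: linear_scale[OF bounded_linear.linear[OF bounded_linear_potential[OF \<open>V \<noteq> {}\<close>]]]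
        potential_point[OF x])
  finally show ?thesis .
qed

end

section \<open>Integrals against the local time\<close>

text \<open>The two measures agree on half-open intervals, which form an intersection-stable
  generator, and are finite on the intervals from -n to n exhausting the line.\<close>

lemma interval_measure_eq_density:
  fixes D :: "real \<Rightarrow> real"
  assumes [measurable]: "D \<in> borel_measurable borel" and D: "\<And>s. 0 \<le> D s" "\<And>s. D s \<le> 1"
    and F: "\<And>a b. a \<le> b \<Longrightarrow> F b - F a = (LINT s|lborel. indicat_real {a<..b} s * D s)"
  shows "interval_measure F = density lborel (\<lambda>s. ennreal (D s))"
proof -
  have integrable: "integrable lborel (\<lambda>s. indicat_real {a<..b} s * D s)" for a b :: real
  proof (rule Bochner_Integration.integrable_bound[of _ "indicat_real {a<..b}"])
    show "integrable lborel (indicat_real {a<..b})"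
      by (cases "a \<le> b") (auto intro!: integrable_real_indicator)
    show "AE s in lborel. norm (indicat_real {a<..b} s * D s) \<le> norm (indicat_real {a<..b} s)"
      using D by (intro AE_I2) (simp add: indicator_def)
  qed simp
  have F_mono: "F a \<le> F b" if "a \<le> b" for a b
  proof -
    have "0 \<le> (LINT s|lborel. indicat_real {a<..b} s * D s)"
      by (intro integral_nonneg_AE AE_I2) (simp add: D)
    thus ?thesis using F[OF that] by simp
  qed
  have F_le: "F b - F a \<le> b - a" if "a \<le> b" for a b
  proof -
    have "F b - F a \<le> (LINT s|lborel. indicat_real {a<..b} s)"
      unfolding F[OF that]
      by (intro integral_mono integrable integrable_real_indicator) (auto simp: indicator_def D that)
    thus ?thesis using that by simp
  qed
  \<comment> \<open>The bounds on \<open>D\<close> make \<open>F\<close> Lipschitz, hence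
    right-continuous, as the formula for interval measures requires.\<close>
  have "1-lipschitz_on UNIV F"
  proof (rule lipschitz_onI)
    fix a b :: real
    show "dist (F a) (F b) \<le> 1 * dist a b"
      using F_le[of a b] F_mono[of a b] F_le[of b a] F_mono[of b a]
      by (cases "a \<le> b") (auto simp: dist_real_def)
  qed simp
  hence "continuous_on UNIV F"
    by (rule lipschitz_on_continuous_on)
  hence F_cont: "continuous (at_right a) F" for a
    by (simp add: continuous_on_eq_continuous_at continuous_at_imp_continuous_within)
  have Ioc: "emeasure (interval_measure F) {a<..b} = emeasure (density lborel (\<lambda>s. ennreal (D s))) {a<..b}"
    if "a \<le> b" for a b
  proof -
    have "emeasure (density lborel (\<lambda>s. ennreal (D s))) {a<..b}
        = (\<integral>\<^sup>+s. ennreal (indicat_real {a<..b} s * D s) \<partial>lborel)"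
      by (subst emeasure_density) (auto intro!: nn_integral_cong simp: indicator_def)
    also have "\<dots> = ennreal (F b - F a)"
      unfolding F[OF that] by (intro nn_integral_eq_integral integrable) (simp add: D)
    finally show ?thesis
      using emeasure_interval_measure_Ioc[OF that F_mono F_cont] by simp
  qed
  show ?thesis
  proof (rule measure_eqI_generator_eq[where \<Omega> = UNIV and E = "range (\<lambda>(a, b). {a<..b})"
        and A = "\<lambda>n. {- real n<..real n}"])
    show "Int_stable (range (\<lambda>(a, b). {a<..b::real}))"
    proof (rule Int_stableI)
      fix U W :: "real set" assume "U \<in> range (\<lambda>(a, b). {a<..b})" "W \<in> range (\<lambda>(a, b). {a<..b})"
      then obtain a b c d where "U = {a<..b}" "W = {c<..d}" by auto
      hence "U \<inter> W = {max a c<..min b d}" by auto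
      thus "U \<inter> W \<in> range (\<lambda>(a, b). {a<..b})" by auto
    qed
    fix U :: "real set" assume "U \<in> range (\<lambda>(a, b). {a<..b})"
    then obtain a b where "U = {a<..b}" by auto
    thus "emeasure (interval_measure F) U = emeasure (density lborel (\<lambda>s. ennreal (D s))) U"
      using Ioc[of a b] by (cases "a \<le> b") auto
  next
    show "(\<Union>n. {- real n<..real n}) = UNIV"
    proof (rule UNIV_eq_I[symmetric])
      fix x :: real
      obtain n where "\<bar>x\<bar> < real n" using reals_Archimedean2 by blast
      thus "x \<in> (\<Union>n. {- real n<..real n})" by (auto intro!: exI[of _ n])
    qed
    show "emeasure (interval_measure F) {- real n<..real n} \<noteq> \<infinity>" for n
      using emeasure_interval_measure_Ioc[OF _ F_mono F_cont, of "- real n" "real n"] by simp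
  qed (auto simp: borel_sigma_sets_Ioc sets_measure_of)
qed

lemma local_time_integral_eq:
  assumes path: "(\<lambda>s. Y s \<omega>) \<in> restrict_space borel {0..} \<rightarrow>\<^sub>M count_space V"
    and \<phi>: "\<phi> \<in> functions_on B"
  shows "local_time_integral B Y \<phi> t \<omega> = (LINT s:{0..t}|lborel. \<phi> (Y s \<omega>))"
proof -
  have meas: "(\<lambda>s. indicat_real {0..} s * f (Y s \<omega>)) \<in> borel_measurable borel" for f :: "_ \<Rightarrow> real"
  proof -
    have "(\<lambda>s. f (Y s \<omega>)) \<in> borel_measurable (restrict_space borel {0..})"
      by (rule measurable_compose[OF path]) simp
    thus ?thesis
      by (subst (asm) borel_measurable_restrict_space_iff) simp_all
  qed
  \<comment> \<open>The cut at 0 matches the vanishing of the local time at negative times; it is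
    also necessary because the path is known to be measurable only on the half line.\<close>
  define D where "D s = indicat_real {0..} s * indicat_real B (Y s \<omega>)" for s
  have [measurable]: "D \<in> borel_measurable borel"
    unfolding D_def[abs_def] by (rule meas)
  have D: "0 \<le> D s" "D s \<le> 1" for s by (auto simp: D_def indicator_def)
  have F: "local_time B Y r \<omega> = (LINT s|lborel. indicat_real {0..r} s * D s)" for r
    unfolding local_time_def set_lebesgue_integral_def
    by (intro Bochner_Integration.integral_cong) (auto simp: D_def indicator_def)
  have integrable: "integrable lborel (\<lambda>s. indicat_real {0..r} s * D s)" for r
    by (rule Bochner_Integration.integrable_bound[of _ "indicat_real {0..r}"])
      (use D in \<open>auto simp: indicator_def emeasure_lborel_Icc_eq intro!: integrable_real_indicator\<close>)
  have "local_time B Y b \<omega> - local_time B Y a \<omega> = (LINT s|lborel. indicat_real {a<..b} s * D s)"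
    if "a \<le> b" for a b
    unfolding F Bochner_Integration.integral_diff[OF integrable integrable, symmetric]
    using that by (intro Bochner_Integration.integral_cong) (auto simp: D_def indicator_def)
  hence density: "interval_measure (\<lambda>r. local_time B Y r \<omega>) = density lborel (\<lambda>s. ennreal (D s))"
    by (intro interval_measure_eq_density D) simp_all
  have "(\<lambda>s. indicat_real {0..t} s * (indicat_real {0..} s * \<phi> (Y s \<omega>))) \<in> borel_measurable borel"
    using meas[of \<phi>] by measurable
  also have "(\<lambda>s. indicat_real {0..t} s * (indicat_real {0..} s * \<phi> (Y s \<omega>)))
      = (\<lambda>s. indicat_real {0..t} s *\<^sub>R \<phi> (Y s \<omega>))"
    by (auto simp: indicator_def)
  finally have "(\<lambda>s. indicat_real {0..t} s *\<^sub>R \<phi> (Y s \<omega>)) \<in> borel_measurable lborel"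
    by simp
  hence "local_time_integral B Y \<phi> t \<omega> = (LINT s|lborel. D s *\<^sub>R (indicat_real {0..t} s *\<^sub>R \<phi> (Y s \<omega>)))"
    unfolding local_time_integral_def set_lebesgue_integral_def density
    by (rule integral_density) (simp_all add: D)
  \<comment> \<open>The density drops out: \<phi> already vanishes off \<open>B\<close>, and the
    times in question are nonnegative.\<close>
  also have "\<dots> = (LINT s:{0..t}|lborel. \<phi> (Y s \<omega>))"
    unfolding set_lebesgue_integral_def using \<phi>
    by (intro Bochner_Integration.integral_cong) (auto simp: D_def indicator_def functions_on_def)
  finally show ?thesis .
qed

text \<open>Restricting time to [0, t] makes the product measure finite, so joint measurability of
  the process and boundedness of \<phi> are enough for Fubini.\<close>

lemma expectation_local_time_integral:
  fixes M :: "'w measure" and P :: "'a \<Rightarrow> 'w measure"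
  assumes proc: "markov_process V M P Y" and x: "x \<in> V"
    and \<phi>: "\<phi> \<in> functions_on B" "\<And>y. \<bar>\<phi> y\<bar> \<le> C"
    and h: "\<And>s. 0 \<le> s \<Longrightarrow> has_bochner_integral (P x) (\<lambda>\<omega>. \<phi> (Y s \<omega>)) (h s)"
  shows "(\<integral>\<omega>. local_time_integral B Y \<phi> t \<omega> \<partial>P x) = (LINT s:{0..t}|lborel. h s)"
proof -
  have prob: "prob_space (P x)" and sets: "sets (P x) = sets M"
    and joint: "(\<lambda>(s, \<omega>). Y s \<omega>) \<in> restrict_space borel {0..} \<Otimes>\<^sub>M M \<rightarrow>\<^sub>M count_space V"
    using proc x unfolding markov_process_def by auto
  have space: "space (P x) = space M"
    using sets by (rule sets_eq_imp_space_eq)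
  define N where "N = restrict_space lborel {0..t}"
  have space_N: "space N = {0..t}"
    by (simp add: N_def)
  interpret P: prob_space "P x" by (rule prob)
  interpret N: finite_measure N
    by (rule finite_measureI) (simp add: N_def emeasure_restrict_space emeasure_lborel_Icc_eq)
  interpret pair: pair_sigma_finite N "P x" ..
  interpret prod: finite_measure "N \<Otimes>\<^sub>M P x"
    by (rule finite_measureI)
      (simp add: space_pair_measure P.emeasure_pair_measure_Times ennreal_mult_eq_top_iff)
  have path: "(\<lambda>s. Y s \<omega>) \<in> restrict_space borel {0..} \<rightarrow>\<^sub>M count_space V" if "\<omega> \<in> space M" for \<omega>
    using measurable_compose[OF measurable_Pair2'[OF that] joint] by simp
  have "(\<lambda>s. s) \<in> N \<rightarrow>\<^sub>M restrict_space borel {0..}"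
    unfolding N_def
    by (rule measurable_restrict_space2) (auto intro!: measurable_restrict_space1)
  hence "(\<lambda>p. (fst p, snd p)) \<in> N \<Otimes>\<^sub>M P x \<rightarrow>\<^sub>M restrict_space borel {0..} \<Otimes>\<^sub>M M"
    by (rule measurable_Pair[OF measurable_compose[OF measurable_fst]
          measurable_compose[OF measurable_snd measurable_ident_sets[OF sets]]])
  from measurable_compose[OF measurable_compose[OF this joint], of \<phi> borel]
  have "(\<lambda>(s, \<omega>). \<phi> (Y s \<omega>)) \<in> borel_measurable (N \<Otimes>\<^sub>M P x)"
    by (simp add: split_def)
  hence integrable: "integrable (N \<Otimes>\<^sub>M P x) (\<lambda>(s, \<omega>). \<phi> (Y s \<omega>))"
    by (intro prod.integrable_const_bound[of _ C]) (auto simp: \<phi>(2))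
  have "(\<integral>\<omega>. local_time_integral B Y \<phi> t \<omega> \<partial>P x) = (\<integral>\<omega>. \<integral>s. \<phi> (Y s \<omega>) \<partial>N \<partial>P x)"
  proof (rule Bochner_Integration.integral_cong)
    fix \<omega> assume "\<omega> \<in> space (P x)"
    hence "local_time_integral B Y \<phi> t \<omega> = (LINT s:{0..t}|lborel. \<phi> (Y s \<omega>))"
      by (intro local_time_integral_eq[OF path \<phi>(1)]) (simp add: space)
    thus "local_time_integral B Y \<phi> t \<omega> = (\<integral>s. \<phi> (Y s \<omega>) \<partial>N)"
      by (simp add: N_def integral_restrict_space set_lebesgue_integral_def)
  qed simp
  also have "\<dots> = (\<integral>s. \<integral>\<omega>. \<phi> (Y s \<omega>) \<partial>P x \<partial>N)"
    by (rule pair.Fubini_integral) (rule integrable)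
  also have "\<dots> = (\<integral>s. h s \<partial>N)"
    by (intro Bochner_Integration.integral_cong refl)
      (simp add: space_N has_bochner_integral_integral_eq[OF h])
  also have "\<dots> = (LINT s:{0..t}|lborel. h s)"
    by (simp add: N_def integral_restrict_space set_lebesgue_integral_def)
  finally show ?thesis .
qed

section \<open>The Neumann problem\<close>

context neumann_semigroup
begin

lemma potential_weak_solution:
  assumes \<phi>: "\<phi> \<in> ell2 V m" and mean: "(\<Sum>\<^sub>\<infinity>x\<in>V. \<phi> x * m x) = 0"
    and V: "V \<noteq> {}" and v: "v \<in> form_domain V c m"
  shows "neumann_form V c (of_l2 (potential (to_l2 \<phi>))) v = ell2_inner V m \<phi> v"
proof -
  have "inner (to_l2 \<phi>) one = 0"
    using infsumI[OF inner_one[OF \<phi>]] mean by simp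
  hence "projection (to_l2 \<phi>) = to_l2 \<phi>"
    by (intro projection_id to_l2_in_complement \<phi>)
  thus ?thesis
    using gen_form(2)[OF gen_potential[OF V] v, of "to_l2 \<phi>"]
    by (simp add: ell2_inner_eq \<phi> form_domain_ell2[OF v])
qed

lemma potential_mean: "V \<noteq> {} \<Longrightarrow> ((\<lambda>x. of_l2 (potential u) x * m x) has_sum 0) V"
  using inner_one[OF of_l2_in_ell2, of "potential u"] potential_in_complement[of u]
  by (simp add: complement_to_l2_of_l2 complement_iff)

lemma potential_heat_integral:
  assumes \<phi>: "\<phi> \<in> ell2 V m" and mean: "(\<Sum>\<^sub>\<infinity>x\<in>V. \<phi> x * m x) = 0" and V: "V \<noteq> {}"
  shows "has_bochner_integral (restrict_space lborel {0..}) (\<lambda>s. T s \<phi> x) (of_l2 (potential (to_l2 \<phi>)) x)"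
proof -
  have "inner (to_l2 \<phi>) one = 0"
    using infsumI[OF inner_one[OF \<phi>]] mean by simp
  hence "projection (to_l2 \<phi>) = to_l2 \<phi>"
    by (intro projection_id to_l2_in_complement \<phi>)
  moreover have "of_l2 (S s (to_l2 \<phi>)) x = T s \<phi> x" if "0 \<le> s" for s
    using that by (simp add: of_l2_S of_l2_to_l2 \<phi>)
  hence "has_bochner_integral (restrict_space lborel {0..}) (\<lambda>s. T s \<phi> x) (of_l2 (potential (to_l2 \<phi>)) x)
    \<longleftrightarrow> has_bochner_integral (restrict_space lborel {0..}) (\<lambda>s. of_l2 (S s (to_l2 \<phi>)) x) (of_l2 (potential (to_l2 \<phi>)) x)"
    by (intro has_bochner_integral_cong) simp_all
  ultimately show ?thesis
    using potential_has_bochner_integral[OF V, of "to_l2 \<phi>" x] by simp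
qed

end

text \<open>Once the Laplacian vanishes on \<open>A\<close>, the identity defining the normal
  derivative loses its Laplacian term and becomes a weak equation. Existence and uniqueness are
  thereby reduced to statements about the form.\<close>

lemma solves_neumann_problem_iff:
  assumes \<phi>: "\<phi> \<in> ell2 (vertex_boundary X b A) m"
    and graph: "weighted_graph (vertex_closure X b A) m (induced_graph X b A)"
  shows "solves_neumann_problem X b A m \<phi> u \<longleftrightarrow>
    u \<in> form_domain (vertex_closure X b A) (induced_graph X b A) m \<and>
    (\<forall>v\<in>form_domain (vertex_closure X b A) (induced_graph X b A) m.
      neumann_form (vertex_closure X b A) (induced_graph X b A) u v = ell2_inner (vertex_boundary X b A) m \<phi> v)"
    (is "?L \<longleftrightarrow> ?u \<and> ?R")
proof -
  let ?V = "vertex_closure X b A" and ?c = "induced_graph X b A" and ?B = "vertex_boundary X b A"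
  interpret weighted_graph ?V m ?c by (rule graph)
  have disjoint: "x \<notin> ?B" if "x \<in> A" for x
    using that by (simp add: vertex_boundary_def)
  show ?thesis
  proof
    assume L: ?L
    then obtain \<psi> where u: ?u and Delta: "\<And>x. x \<in> A \<Longrightarrow> Delta X b A m u x = 0"
      and \<psi>: "is_normal_derivative X b A m u \<psi>" "\<And>y. y \<in> ?B \<Longrightarrow> \<psi> y = \<phi> y"
      unfolding solves_neumann_problem_def by blast
    have "ell2_inner A m (Delta X b A m u) v = 0" for v
      unfolding ell2_inner_def by (rule infsum_0) (simp add: Delta)
    moreover have "ell2_inner ?B m \<psi> v = ell2_inner ?B m \<phi> v" for v
      unfolding ell2_inner_def by (rule infsum_cong) (simp add: \<psi>(2))
    ultimately have ?R
      using \<psi>(1) unfolding is_normal_derivative_def by fastforce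
    with u show "?u \<and> ?R" ..
  next
    assume R: "?u \<and> ?R"
    have Delta: "Delta X b A m u x = 0" if x: "x \<in> A" for x
    proof -
      have xV: "x \<in> ?V" using x by (simp add: vertex_closure_def)
      \<comment> \<open>A test function concentrated at a point of \<open>A\<close> vanishes on the
        boundary, so its pairing with \<phi> is 0.\<close>
      have "m x * formal_laplacian ?V ?c m u x = ell2_inner ?B m \<phi> (indicat_real {x})"
        using R neumann_form_point[of u x] point_in_form_domain[OF xV] xV by simp
      also have "\<dots> = 0"
        unfolding ell2_inner_def by (rule infsum_0) (use disjoint[OF x] in \<open>auto simp: indicator_def\<close>)
      finally show ?thesis
        using weight_pos[OF xV] by (simp add: Delta_def)
    qed
    have "is_normal_derivative X b A m u \<phi>"
      using R \<phi> Delta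
      by (auto simp: is_normal_derivative_def ell2_inner_def cong: infsum_cong summable_on_cong)
    with R Delta show ?L
      unfolding solves_neumann_problem_def by blast
  qed
qed

text \<open>The difference is itself an admissible test function, so its energy is 0 and it is
  constant on \<open>V\<close>; mean zero and positive mass leave only 0. Outside \<open>V\<close>
  both functions vanish by the encoding.\<close>

lemma neumann_solution_unique:
  assumes graph: "weighted_graph V m c"
    and u: "u \<in> form_domain V c m" "((\<lambda>x. u x * m x) has_sum 0) V"
    and u': "u' \<in> form_domain V c m" "((\<lambda>x. u' x * m x) has_sum 0) V"
    and eq: "\<And>v. v \<in> form_domain V c m \<Longrightarrow> neumann_form V c u v = neumann_form V c u' v"
  shows "u = u'"
proof
  interpret weighted_graph V m c by (rule graph)
  fix x
  let ?w = "\<lambda>x. u x - u' x"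
  have w: "?w \<in> form_domain V c m"
    by (rule form_domain_diff[OF u(1) u'(1)])
  have "neumann_form V c ?w ?w = 0"
    using neumann_form_diff[OF u(1) u'(1) w] eq[OF w] by simp
  note const = neumann_form_eq_0_imp_const[OF w this]
  show "u x = u' x"
  proof (cases "x \<in> V")
    case True
    have "((\<lambda>y. u y * m y + - (u' y * m y)) has_sum 0 + - 0) V"
      by (intro has_sum_add has_sum_uminusI u u')
    also have "?this \<longleftrightarrow> ((\<lambda>y. ?w x * m y) has_sum 0) V"
      using const[OF _ True] by (auto intro!: has_sum_cong simp: left_diff_distrib[symmetric])
    finally have "?w x * mass = 0"
      by (simp add: has_sum_iff infsum_cmult_right' mass_def)
    thus ?thesis using mass_pos[OF True] by simp
  next
    case False
    thus ?thesis
      using form_domain_ell2[OF u(1)] form_domain_ell2[OF u'(1)] by (simp add: ell2_def functions_on_def)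
  qed
qed

lemma weighted_graph_induced:
  assumes "graph_on X b" and "A \<subset> X" and "connected_graph (vertex_closure X b A) (induced_graph X b A)"
    and "finite_discrete_measure (vertex_closure X b A) m"
  shows "weighted_graph (vertex_closure X b A) m (induced_graph X b A)"
proof unfold_locales
  let ?V = "vertex_closure X b A" and ?c = "induced_graph X b A"
  have VX: "?V \<subseteq> X"
    using assms(2) by (auto simp: vertex_closure_def vertex_boundary_def)
  have b: "0 \<le> b x y" "b x y = b y x" if "x \<in> ?V" "y \<in> ?V" for x y
    using assms(1) VX that unfolding graph_on_def by blast+
  fix x assume x: "x \<in> ?V"
  show "(\<lambda>y. ?c x y) summable_on ?V"
  proof (rule summable_on_comparison_real)
    have "(\<lambda>y. b x y) summable_on X"
      using assms(1) VX x unfolding graph_on_def by blast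
    thus "(\<lambda>y. b x y) summable_on ?V"
      by (rule summable_on_subset_banach) (rule VX)
  qed (auto simp: induced_graph_def b x)
  fix y assume y: "y \<in> ?V"
  show "0 \<le> ?c x y" "?c x y = ?c y x"
    using b[OF x y] by (auto simp: induced_graph_def)
qed (fact assms)+

text \<open>The time integral and the Green sum are stated with \<open>has_bochner_integral\<close>
  and \<open>has_sum\<close>, which assert convergence along with the value; bare integrals and sums
  would default to 0 when divergent.\<close>

theorem theorem3p12:
  fixes X A :: "'a set"
    and b :: "'a \<Rightarrow> 'a \<Rightarrow> real"
    and m \<phi> :: "'a \<Rightarrow> real"
    and T :: "real \<Rightarrow> ('a \<Rightarrow> real) \<Rightarrow> 'a \<Rightarrow> real"
  defines "bdA \<equiv> vertex_boundary X b A"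
    and "clA \<equiv> vertex_closure X b A"
    and "bA \<equiv> induced_graph X b A"
  assumes "graph_on X b"
    and "A \<noteq> {}" and "A \<subset> X"
    and "connected_graph clA bA"
    and "finite_discrete_measure clA m"
    and "is_exp_semigroup clA m (neumann_laplacian clA bA m) T"
    and "ultracontractive clA m T"
    and "\<phi> \<in> ell_infinity bdA"
    and "(\<Sum>\<^sub>\<infinity>x\<in>bdA. \<phi> x * m x) = 0"
  shows "(\<exists>!u. u \<in> functions_on clA \<and> solves_neumann_problem X b A m \<phi> u
              \<and> ((\<lambda>x. u x * m x) has_sum 0) clA)
    \<and> (\<forall>u. u \<in> functions_on clA \<and> solves_neumann_problem X b A m \<phi> u
              \<and> ((\<lambda>x. u x * m x) has_sum 0) clA \<longrightarrow>
        (\<forall>x\<in>clA.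
          (\<forall>(M :: 'w measure) P Y. associated_process clA m T M P Y \<longrightarrow>
             ((\<lambda>t. \<integral>\<omega>. local_time_integral bdA Y \<phi> t \<omega> \<partial>P x) \<longlongrightarrow> u x) at_top)
          \<and> has_bochner_integral (restrict_space lborel {0..})
               (\<lambda>s. \<Sum>\<^sub>\<infinity>y\<in>bdA. \<phi> y * heat_kernel m T s x y * m y) (u x)
          \<and> ((\<lambda>y. \<phi> y * green_kernel clA m T x y * m y) has_sum u x) bdA))"
proof -
  have graph: "weighted_graph clA m bA"
    unfolding clA_def bA_def using assms by (intro weighted_graph_induced) (simp_all add: clA_def bA_def)
  interpret neumann_semigroup clA m bA T
    using graph assms by (intro neumann_semigroup.intro neumann_semigroup_axioms.intro)
  have ne: "clA \<noteq> {}" and bd_cl: "bdA \<subseteq> clA"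
    using \<open>A \<noteq> {}\<close> by (auto simp: clA_def bdA_def vertex_closure_def)
  have outside: "\<phi> x = 0" if "x \<notin> bdA" for x
    using \<open>\<phi> \<in> ell_infinity bdA\<close> that by (simp add: ell_infinity_def functions_on_def)
  obtain C where C: "\<And>x. \<bar>\<phi> x\<bar> \<le> C"
  proof -
    obtain C where "\<And>x. x \<in> bdA \<Longrightarrow> \<bar>\<phi> x\<bar> \<le> C"
      using \<open>\<phi> \<in> ell_infinity bdA\<close> by (auto simp: ell_infinity_def bounded_iff)
    \<comment> \<open>The absolute value keeps the bound valid off the boundary, also when the
      boundary is empty and \<open>C\<close> is negative.\<close>
    hence "\<bar>\<phi> x\<bar> \<le> \<bar>C\<bar>" for x
      using outside[of x] by (cases "x \<in> bdA") (force intro: order_trans[OF _ abs_ge_self])+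
    thus thesis by (rule that)
  qed
  have \<phi>_cl: "\<phi> \<in> ell2 clA m"
    using outside bd_cl C by (intro bounded_in_ell2(1)[of _ C]) (auto simp: functions_on_def)
  \<comment> \<open>\<phi> is its own extension by 0, so sums weighted by it may be taken over the
    closure, where the semigroup lives, or over the boundary.\<close>
  have to_bd: "(f has_sum s) clA \<longleftrightarrow> (f has_sum s) bdA"
    if "\<And>x. x \<notin> bdA \<Longrightarrow> f x = 0" for f :: "'a \<Rightarrow> real" and s
    by (rule has_sum_cong_neutral) (use bd_cl that in auto)
  have \<phi>_bd: "\<phi> \<in> ell2 bdA m"
    using \<phi>_cl summable_on_subset_banach[OF _ bd_cl, of "\<lambda>x. (\<phi> x)\<^sup>2 * m x"] outside
    by (simp add: ell2_def functions_on_def)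
  have infsum_bd: "infsum f clA = infsum f bdA" if "\<And>x. x \<notin> bdA \<Longrightarrow> f x = 0" for f :: "'a \<Rightarrow> real"
    by (rule infsum_cong_neutral) (use bd_cl that in auto)
  have mean: "(\<Sum>\<^sub>\<infinity>x\<in>clA. \<phi> x * m x) = 0"
    using assms(12) by (simp add: infsum_bd outside)
  have inner_bd: "ell2_inner bdA m \<phi> v = ell2_inner clA m \<phi> v" for v
    unfolding ell2_inner_def by (rule infsum_bd[symmetric]) (simp add: outside)
  have solves_iff: "solves_neumann_problem X b A m \<phi> u \<longleftrightarrow> u \<in> form_domain clA bA m \<and>
      (\<forall>v\<in>form_domain clA bA m. neumann_form clA bA u v = ell2_inner clA m \<phi> v)" for u
    using solves_neumann_problem_iff[of \<phi> X b A m u] \<phi>_bd graph inner_bd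
    by (simp add: clA_def bA_def bdA_def)
  define U where "U = of_l2 (potential (to_l2 \<phi>))"
  have U: "U \<in> functions_on clA" "solves_neumann_problem X b A m \<phi> U" "((\<lambda>x. U x * m x) has_sum 0) clA"
    using of_l2_in_ell2[of "potential (to_l2 \<phi>)"] potential_weak_solution[OF \<phi>_cl mean ne]
      gen_form(1)[OF gen_potential[OF ne]] potential_mean[OF ne]
    by (auto simp: solves_iff U_def ell2_def)
  have unique: "u = U" if "solves_neumann_problem X b A m \<phi> u" "((\<lambda>x. u x * m x) has_sum 0) clA" for u
    using that U solves_iff by (intro neumann_solution_unique[OF graph]) auto
  have heat: "has_bochner_integral (restrict_space lborel {0..}) (\<lambda>s. T s \<phi> x) (U x)" for x
    unfolding U_def by (rule potential_heat_integral[OF \<phi>_cl mean ne])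
  have process: "((\<lambda>t. \<integral>\<omega>. local_time_integral bdA Y \<phi> t \<omega> \<partial>P x) \<longlongrightarrow> U x) at_top"
    if x: "x \<in> clA" and proc: "associated_process clA m T M P Y" for x P Y and M :: "'w measure"
  proof -
    have "has_bochner_integral (P x) (\<lambda>\<omega>. \<phi> (Y s \<omega>)) (T s \<phi> x)" if "0 \<le> s" for s
      using proc x that \<phi>_cl unfolding associated_process_def by blast
    hence "(\<integral>\<omega>. local_time_integral bdA Y \<phi> t \<omega> \<partial>P x) = (LINT s:{0..t}|lborel. T s \<phi> x)" for t
      using proc x outside C
      by (intro expectation_local_time_integral) (auto simp: associated_process_def functions_on_def)
    \<comment> \<open>Absolute integrability on the half line, already known from the gap, makes the
      integrals up to \<open>t\<close> converge to the full integral.\<close>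
    moreover have "((\<lambda>t. LINT s:{0..t}|lborel. T s \<phi> x) \<longlongrightarrow> U x) at_top"
    proof -
      have "set_integrable lborel {0..} (\<lambda>s. T s \<phi> x)" "(LINT s:{0..}|lborel. T s \<phi> x) = U x"
        using heat[of x]
        by (subst (asm) has_bochner_integral_restrict_space,
            simp_all add: has_bochner_integral_iff set_integrable_def set_lebesgue_integral_def)+
      thus ?thesis
        using tendsto_set_lebesgue_integral_at_top[of 0 lborel "\<lambda>s. T s \<phi> x"] by simp
    qed
    ultimately show ?thesis by simp
  qed
  have kernel: "has_bochner_integral (restrict_space lborel {0..})
      (\<lambda>s. \<Sum>\<^sub>\<infinity>y\<in>bdA. \<phi> y * heat_kernel m T s x y * m y) (U x)" for x
  proof -
    have "(\<Sum>\<^sub>\<infinity>y\<in>bdA. \<phi> y * heat_kernel m T s x y * m y) = T s \<phi> x" if "0 \<le> s" for s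
    proof -
      have "(\<Sum>\<^sub>\<infinity>y\<in>bdA. \<phi> y * heat_kernel m T s x y * m y) = (\<Sum>\<^sub>\<infinity>y\<in>bdA. \<phi> y * T s (indicat_real {y}) x)"
        using bd_cl weight_pos by (intro infsum_cong) (force simp: heat_kernel_def)
      also have "\<dots> = T s \<phi> x"
        using infsumI[OF T_has_sum[OF \<phi>_cl that]] by (simp add: infsum_bd outside)
      finally show ?thesis .
    qed
    hence "has_bochner_integral (restrict_space lborel {0..})
        (\<lambda>s. \<Sum>\<^sub>\<infinity>y\<in>bdA. \<phi> y * heat_kernel m T s x y * m y) (U x)
      \<longleftrightarrow> has_bochner_integral (restrict_space lborel {0..}) (\<lambda>s. T s \<phi> x) (U x)"
      by (intro has_bochner_integral_cong) simp_all
    thus ?thesis using heat[of x] by simp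
  qed
  have green: "((\<lambda>y. \<phi> y * green_kernel clA m T x y * m y) has_sum U x) bdA" if "x \<in> clA" for x
    using green_has_sum[OF \<phi>_cl that] by (simp add: to_bd outside U_def)
  show ?thesis
  proof (intro conjI allI impI ballI; (elim conjE)?)
    show "\<exists>!u. u \<in> functions_on clA \<and> solves_neumann_problem X b A m \<phi> u \<and> ((\<lambda>x. u x * m x) has_sum 0) clA"
      by (rule ex1I[of _ U]) (use U unique in blast)+
  next
    fix u x
    assume "solves_neumann_problem X b A m \<phi> u" "((\<lambda>x. u x * m x) has_sum 0) clA" and x: "x \<in> clA"
    hence u: "u = U" by (intro unique)
    show "has_bochner_integral (restrict_space lborel {0..})
        (\<lambda>s. \<Sum>\<^sub>\<infinity>y\<in>bdA. \<phi> y * heat_kernel m T s x y * m y) (u x)"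
      unfolding u by (rule kernel)
    show "((\<lambda>y. \<phi> y * green_kernel clA m T x y * m y) has_sum u x) bdA"
      unfolding u by (rule green[OF x])
    fix M :: "'w measure" and P Y
    assume "associated_process clA m T M P Y"
    thus "((\<lambda>t. \<integral>\<omega>. local_time_integral bdA Y \<phi> t \<omega> \<partial>P x) \<longlongrightarrow> u x) at_top"
      unfolding u by (rule process[OF x])
  qed
qed

end
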